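(* Let $\mathcal{L}:L^2(X,\mu)\to L^2(Y,\nu)$ be an operator with kernel $k$ satisfying conditions (1)–(3) of the context, and assume that the leading singular value $\sigma_1$ of $\mathcal{L}$ is simple. Let $\sigma_2$ be the second singular value of $\mathcal{L}$. Then $$\max\left\{\frac{\langle\mathcal{L}\mathbf{1}_{X_1},\mathbf{1}_{Y_1}\rangle_\nu}{\mu(X_1)}+\frac{\langle\mathcal{L}\mathbf{1}_{X_2},\mathbf{1}_{Y_2}\rangle_\nu}{\mu(X_2)}\right\}\le 1+\sigma_2,$$ where the maximum (supremum) is over all measurable partitions $\{X_1,X_2\}$ of $X$ and $\{Y_1,Y_2\}$ of $Y$ with $\mu(X_k)=\nu(Y_k)$ and $\mu(X_k)>0$ for $k=1,2$; that is, the expression in braces is at most $1+\sigma_2$ for every such pair of partitions.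
   Context: $(X,\mathcal{B}_X,\mu)$ and $(Y,\mathcal{B}_Y,\nu)$ are probability spaces; $L^2(X,\mu)$ and $L^2(Y,\nu)$ are the real $L^2$ spaces with standard inner products $\langle\cdot,\cdot\rangle_\mu$, $\langle\cdot,\cdot\rangle_\nu$. Conditions on $\mathcal{L}$: (1) $(\mathcal{L}f)(y)=\int_X k(x,y)f(x)\,d\mu(x)$, where $k\in L^2(X\times Y,\mathcal{B}_X\times\mathcal{B}_Y,\mu\times\nu)$ is non-negative; (2) $\mathcal{L}\mathbf{1}_X=\mathbf{1}_Y$, i.e. $\int_X k(x,y)\,d\mu(x)=1$ for $\nu$-a.a. $y$; (3) $\mathcal{L}^*\mathbf{1}_Y=\mathbf{1}_X$, i.e. $\int_Y k(x,y)\,d\nu(y)=1$ for $\mu$-a.a. $x$, where $\mathcal{L}^*$ is the Hilbert space adjoint. Under (1) $\mathcal{L}$ is compact. The singular values of $\mathcal{L}$ are $\sigma_l=\lambda_l^{1/2}$, where $\lambda_1\ge\lambda_2\ge\dots\ge0$ are the eigenvalues of the compact, self-adjoint, positive operator $\mathcal{L}^*\mathcal{L}$ on $L^2(X,\mu)$, repeated according to multiplicity (with $\sigma_2=0$ if there is no second positive eigenvalue). "Simple" means that the eigenvalue $\lambda_1$ has multiplicity one. *)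

theory Defs
  imports "HOL-Probability.Probability_Measure" "HOL-Library.Extended_Nat"
begin

text \<open>
  Elements of the real space \<open>L\<^sup>2(M)\<close> are represented by functions; two representatives are the
  same element iff they agree almost everywhere. Operators between such spaces act on
  representatives, and only their values on square-integrable functions, up to almost everywhere
  equality, are relevant.
\<close>

definition l2_space :: "'a measure \<Rightarrow> ('a \<Rightarrow> real) set" where
  "l2_space M = {f \<in> borel_measurable M. integrable M (\<lambda>x. (f x)\<^sup>2)}"

definition l2_inner :: "'a measure \<Rightarrow> ('a \<Rightarrow> real) \<Rightarrow> ('a \<Rightarrow> real) \<Rightarrow> real" where
  "l2_inner M f g = (\<integral>x. f x * g x \<partial>M)"

definition kernel_op :: "'a measure \<Rightarrow> ('a \<Rightarrow> 'b \<Rightarrow> real) \<Rightarrow> ('a \<Rightarrow> real) \<Rightarrow> 'b \<Rightarrow> real" where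
  "kernel_op M k f = (\<lambda>y. \<integral>x. k x y * f x \<partial>M)"

text \<open>
  The defining identity determines the Hilbert space adjoint on square-integrable functions up to
  almost everywhere equality. The choice operator only selects representatives.
\<close>

definition is_l2_adjoint ::
    "'a measure \<Rightarrow> 'b measure \<Rightarrow> (('a \<Rightarrow> real) \<Rightarrow> ('b \<Rightarrow> real)) \<Rightarrow> (('b \<Rightarrow> real) \<Rightarrow> ('a \<Rightarrow> real)) \<Rightarrow> bool" where
  "is_l2_adjoint M N T S \<longleftrightarrow>
     (\<forall>g \<in> l2_space N. S g \<in> l2_space M \<and>
        (\<forall>f \<in> l2_space M. l2_inner N (T f) g = l2_inner M f (S g)))"

definition l2_adjoint ::
    "'a measure \<Rightarrow> 'b measure \<Rightarrow> (('a \<Rightarrow> real) \<Rightarrow> ('b \<Rightarrow> real)) \<Rightarrow> (('b \<Rightarrow> real) \<Rightarrow> ('a \<Rightarrow> real))" where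
  "l2_adjoint M N T = (SOME S. is_l2_adjoint M N T S)"

definition l2_eigenspace ::
    "'a measure \<Rightarrow> (('a \<Rightarrow> real) \<Rightarrow> ('a \<Rightarrow> real)) \<Rightarrow> real \<Rightarrow> ('a \<Rightarrow> real) set" where
  "l2_eigenspace M A t = {f \<in> l2_space M. AE x in M. A f x = t * f x}"

text \<open>Linear independence of \<open>f 0, \<dots>, f (n - 1)\<close> as elements of \<open>L\<^sup>2(M)\<close>.\<close>

definition l2_independent :: "'a measure \<Rightarrow> nat \<Rightarrow> (nat \<Rightarrow> 'a \<Rightarrow> real) \<Rightarrow> bool" where
  "l2_independent M n f \<longleftrightarrow>
     (\<forall>c :: nat \<Rightarrow> real. (AE x in M. (\<Sum>i<n. c i * f i x) = 0) \<longrightarrow> (\<forall>i<n. c i = 0))"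

definition l2_dim :: "'a measure \<Rightarrow> ('a \<Rightarrow> real) set \<Rightarrow> enat" where
  "l2_dim M V = Sup {enat n | n. \<exists>f. (\<forall>i<n. f i \<in> V) \<and> l2_independent M n f}"

definition l2_multiplicity ::
    "'a measure \<Rightarrow> (('a \<Rightarrow> real) \<Rightarrow> ('a \<Rightarrow> real)) \<Rightarrow> real \<Rightarrow> enat" where
  "l2_multiplicity M A t = l2_dim M (l2_eigenspace M A t)"

text \<open>
  \<open>lam 1 \<ge> lam 2 \<ge> \<dots> \<ge> 0\<close> lists the eigenvalues of the compact positive operator \<open>A\<close>, each
  positive number \<open>t\<close> occurring exactly as often as its multiplicity (so not at all if it is not an
  eigenvalue). If there are only finitely many positive eigenvalues, the list continues with
  zeros. The index \<open>0\<close> is not used. For \<open>l \<ge> 1\<close> these conditions determine \<open>lam l\<close> uniquely.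
\<close>

definition is_eigenvalue_seq ::
    "'a measure \<Rightarrow> (('a \<Rightarrow> real) \<Rightarrow> ('a \<Rightarrow> real)) \<Rightarrow> (nat \<Rightarrow> real) \<Rightarrow> bool" where
  "is_eigenvalue_seq M A lam \<longleftrightarrow>
     (\<forall>l \<ge> 1. 0 \<le> lam l) \<and>
     (\<forall>l \<ge> 1. lam (Suc l) \<le> lam l) \<and>
     (\<forall>t > 0. finite {l. 1 \<le> l \<and> lam l = t} \<and>
        enat (card {l. 1 \<le> l \<and> lam l = t}) = l2_multiplicity M A t)"

definition eigenvalue_seq ::
    "'a measure \<Rightarrow> (('a \<Rightarrow> real) \<Rightarrow> ('a \<Rightarrow> real)) \<Rightarrow> nat \<Rightarrow> real" where
  "eigenvalue_seq M A = (SOME lam. is_eigenvalue_seq M A lam)"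

definition singular_value ::
    "'a measure \<Rightarrow> 'b measure \<Rightarrow> (('a \<Rightarrow> real) \<Rightarrow> ('b \<Rightarrow> real)) \<Rightarrow> nat \<Rightarrow> real" where
  "singular_value M N T l = sqrt (eigenvalue_seq M (l2_adjoint M N T \<circ> T) l)"

definition simple_singular_value ::
    "'a measure \<Rightarrow> 'b measure \<Rightarrow> (('a \<Rightarrow> real) \<Rightarrow> ('b \<Rightarrow> real)) \<Rightarrow> nat \<Rightarrow> bool" where
  "simple_singular_value M N T l \<longleftrightarrow>
     l2_multiplicity M (l2_adjoint M N T \<circ> T) (eigenvalue_seq M (l2_adjoint M N T \<circ> T) l) = 1"

text \<open>Measurable partitions of the underlying space into two parts.\<close>

definition measurable_bipartition :: "'a measure \<Rightarrow> 'a set \<Rightarrow> 'a set \<Rightarrow> bool" where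
  "measurable_bipartition M A B \<longleftrightarrow>
     A \<in> sets M \<and> B \<in> sets M \<and> A \<inter> B = {} \<and> A \<union> B = space M"

end

theory Submission
  imports Defs
begin

text \<open>
  Write \<open>L\<close> for the operator with kernel \<open>k\<close> and \<open>A = L\<^sup>* L\<close>. Conditions (2) and (3) make the constant
  function an eigenfunction of \<open>A\<close> with eigenvalue \<open>1\<close>, and \<open>L\<close> is a contraction. With
  \<open>p = \<mu>(X\<^sub>1)\<close>, \<open>f = 1 - p\<close> on \<open>X\<^sub>1\<close> and \<open>f = -p\<close> on \<open>X\<^sub>2\<close>, and \<open>g\<close> defined likewise from \<open>Y\<^sub>1\<close>, the quantity to
  be bounded equals \<open>1 + \<langle>L f, g\<rangle> / (p (1 - p))\<close>. Both norms are \<open>sqrt (p (1 - p))\<close>, so the claim follows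
  from \<open>\<parallel>L f\<parallel> \<le> \<sigma>\<^sub>2 \<parallel>f\<parallel>\<close> for \<open>f\<close> orthogonal to constants.

  For this last bound, the power iteration \<open>A\<^sup>n f / r\<^sup>n\<close>, with \<open>r\<close> the limit of the increasing ratios
  \<open>\<langle>A\<^sup>n\<^sup>+\<^sup>1 f, f\<rangle> / \<langle>A\<^sup>n f, f\<rangle>\<close>, is Cauchy and its limit is an eigenfunction of \<open>A\<close> orthogonal to constants
  with eigenvalue \<open>r \<ge> \<parallel>L f\<parallel>\<^sup>2 / \<parallel>f\<parallel>\<^sup>2\<close>. The limit does not vanish: otherwise the normalised iterates
  would contain arbitrarily many almost orthonormal functions whose images under \<open>L\<close> are bounded
  below in norm, contradicting the Hilbert-Schmidt bound. The same bound shows that the eigenvalues of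
  \<open>A\<close> above any positive threshold have finite total multiplicity, so they can be enumerated.
\<close>

subsection \<open>Square-integrable functions\<close>

lemma abs_mult_le_mean_squares: "\<bar>a * b\<bar> \<le> (a\<^sup>2 + b\<^sup>2) / 2" for a b :: real
  using sum_squares_bound[of "\<bar>a\<bar>" "\<bar>b\<bar>"] by (simp add: abs_mult)

lemma l2_spaceD:
  assumes "f \<in> l2_space M"
  shows "f \<in> borel_measurable M" "integrable M (\<lambda>x. (f x)\<^sup>2)"
  using assms by (auto simp: l2_space_def)

lemma integrable_l2_mult:
  assumes "f \<in> l2_space M" "g \<in> l2_space M"
  shows "integrable M (\<lambda>x. f x * g x)"
proof (rule Bochner_Integration.integrable_bound)
  show "integrable M (\<lambda>x. (f x)\<^sup>2 + (g x)\<^sup>2)"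
    using assms by (auto dest: l2_spaceD)
  show "(\<lambda>x. f x * g x) \<in> borel_measurable M"
    by (intro borel_measurable_times l2_spaceD assms)
  show "AE x in M. norm (f x * g x) \<le> norm ((f x)\<^sup>2 + (g x)\<^sup>2)"
  proof (rule AE_I2)
    fix x
    have "0 \<le> (f x)\<^sup>2 + (g x)\<^sup>2" by simp
    then show "norm (f x * g x) \<le> norm ((f x)\<^sup>2 + (g x)\<^sup>2)"
      using abs_mult_le_mean_squares[of "f x" "g x"] by simp
  qed
qed

lemma l2_add:
  assumes "f \<in> l2_space M" "g \<in> l2_space M"
  shows "(\<lambda>x. f x + g x) \<in> l2_space M"
  using assms integrable_l2_mult[OF assms]
  by (auto simp: l2_space_def power2_sum mult.assoc)

lemma l2_scale:
  assumes "f \<in> l2_space M"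
  shows "(\<lambda>x. c * f x) \<in> l2_space M"
  using assms by (auto simp: l2_space_def power_mult_distrib)

lemma l2_diff:
  assumes "f \<in> l2_space M" "g \<in> l2_space M"
  shows "(\<lambda>x. f x - g x) \<in> l2_space M"
  using l2_add[OF assms(1) l2_scale[OF assms(2), of "-1"]] by simp

lemma l2_sum:
  assumes "\<And>i. i \<in> I \<Longrightarrow> f i \<in> l2_space M"
  shows "(\<lambda>x. \<Sum>i\<in>I. f i x) \<in> l2_space M"
  using assms
proof (induction I rule: infinite_finite_induct)
  case (insert i I)
  then show ?case using l2_add[of "f i" M "\<lambda>x. \<Sum>i\<in>I. f i x"] by simp
qed (auto simp: l2_space_def)

lemma l2_const: "finite_measure M \<Longrightarrow> (\<lambda>_. c) \<in> l2_space M"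
  by (simp add: l2_space_def finite_measure.integrable_const)

lemma l2_indicator:
  assumes "finite_measure M" "X \<in> sets M"
  shows "indicator X \<in> l2_space M"
proof -
  have "(\<lambda>x. (indicator X x :: real)\<^sup>2) = indicator X"
    by (auto simp: indicator_def)
  then show ?thesis
    using assms finite_measure.emeasure_finite[OF assms(1), of X]
    by (simp add: l2_space_def integrable_indicator_iff top.not_eq_extremum)
qed

section \<open>Algebra of the inner product on representatives\<close>

lemma l2_inner_commute: "l2_inner M f g = l2_inner M g f"
  by (simp add: l2_inner_def mult.commute)

lemma l2_inner_add_left:
  assumes "f \<in> l2_space M" "g \<in> l2_space M" "h \<in> l2_space M"
  shows "l2_inner M (\<lambda>x. f x + g x) h = l2_inner M f h + l2_inner M g h"
  using assms by (simp add: l2_inner_def distrib_right integrable_l2_mult)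

lemma l2_inner_diff_left:
  assumes "f \<in> l2_space M" "g \<in> l2_space M" "h \<in> l2_space M"
  shows "l2_inner M (\<lambda>x. f x - g x) h = l2_inner M f h - l2_inner M g h"
  using assms by (simp add: l2_inner_def left_diff_distrib integrable_l2_mult)

lemma l2_inner_scale_left: "l2_inner M (\<lambda>x. c * f x) h = c * l2_inner M f h"
  by (simp add: l2_inner_def mult.assoc)

lemma l2_inner_scale_right: "l2_inner M h (\<lambda>x. c * f x) = c * l2_inner M h f"
  by (metis l2_inner_commute l2_inner_scale_left)

lemma l2_inner_diff_right:
  assumes "f \<in> l2_space M" "g \<in> l2_space M" "h \<in> l2_space M"
  shows "l2_inner M h (\<lambda>x. f x - g x) = l2_inner M h f - l2_inner M h g"
  using l2_inner_diff_left[OF assms] by (simp add: l2_inner_commute)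

lemma l2_inner_sum_left:
  assumes "\<And>i. i \<in> I \<Longrightarrow> f i \<in> l2_space M" "h \<in> l2_space M"
  shows "l2_inner M (\<lambda>x. \<Sum>i\<in>I. f i x) h = (\<Sum>i\<in>I. l2_inner M (f i) h)"
  using assms by (simp add: l2_inner_def sum_distrib_right integrable_l2_mult)

lemma l2_inner_sum_right:
  assumes "\<And>i. i \<in> I \<Longrightarrow> f i \<in> l2_space M" "h \<in> l2_space M"
  shows "l2_inner M h (\<lambda>x. \<Sum>i\<in>I. f i x) = (\<Sum>i\<in>I. l2_inner M h (f i))"
  using l2_inner_sum_left[OF assms] by (simp add: l2_inner_commute)

lemma l2_inner_cong_AE:
  assumes "AE x in M. f x = f' x" "f \<in> borel_measurable M" "f' \<in> borel_measurable M"
    "g \<in> borel_measurable M"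
  shows "l2_inner M f g = l2_inner M f' g"
  unfolding l2_inner_def
  by (rule integral_cong_AE) (use assms in auto)

lemma l2_inner_self_nonneg [simp]: "0 \<le> l2_inner M f f"
  by (simp add: l2_inner_def)

lemma l2_inner_self_eq_0_iff:
  assumes "f \<in> l2_space M"
  shows "l2_inner M f f = 0 \<longleftrightarrow> (AE x in M. f x = 0)"
  unfolding l2_inner_def
  using assms by (subst integral_nonneg_eq_0_iff_AE) (auto intro: integrable_l2_mult)

text \<open>Testing against \<open>h = f - g\<close> makes the norm of the difference vanish. This
  turns weak identities, the only kind the defining property of an adjoint gives directly, into
  almost everywhere equalities.\<close>

lemma l2_AE_eqI:
  assumes f: "f \<in> l2_space M" and g: "g \<in> l2_space M"
    and eq: "\<And>h. h \<in> l2_space M \<Longrightarrow> l2_inner M f h = l2_inner M g h"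
  shows "AE x in M. f x = g x"
proof -
  have d: "(\<lambda>x. f x - g x) \<in> l2_space M" using f g by (rule l2_diff)
  have "l2_inner M (\<lambda>x. f x - g x) (\<lambda>x. f x - g x) = 0"
    using eq[OF d] by (subst l2_inner_diff_left[OF f g d]) simp
  then show ?thesis using l2_inner_self_eq_0_iff[OF d] by simp
qed

section \<open>Cauchy-Schwarz and Bessel inequalities\<close>

lemma l2_Cauchy_Schwarz:
  assumes f: "f \<in> l2_space M" and g: "g \<in> l2_space M"
  shows "(l2_inner M f g)\<^sup>2 \<le> l2_inner M f f * l2_inner M g g"
proof (cases "l2_inner M g g = 0")
  case True
  then have "AE x in M. f x * g x = 0"
    using l2_inner_self_eq_0_iff[OF g] by auto
  then have "l2_inner M f g = 0"
    unfolding l2_inner_def by (rule integral_eq_zero_AE)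
  then show ?thesis using True by simp
next
  case False
  \<comment> \<open>\<open>t * g\<close> is the orthogonal projection of \<open>f\<close> onto the
    line spanned by \<open>g\<close>; the claim is that the remainder has nonnegative squared
    norm.\<close>
  define t where "t = l2_inner M f g / l2_inner M g g"
  have tg: "(\<lambda>x. t * g x) \<in> l2_space M" using g by (rule l2_scale)
  have d: "(\<lambda>x. f x - t * g x) \<in> l2_space M" using f tg by (rule l2_diff)
  have "0 \<le> l2_inner M (\<lambda>x. f x - t * g x) (\<lambda>x. f x - t * g x)" by simp
  also have "\<dots> = l2_inner M f f - 2 * t * l2_inner M f g + t\<^sup>2 * l2_inner M g g"
    by (simp add: l2_inner_diff_left[OF f tg d] l2_inner_diff_right[OF f tg f]
        l2_inner_diff_right[OF f tg g]
        l2_inner_scale_left l2_inner_scale_right l2_inner_commute[of M g f]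
        power2_eq_square algebra_simps)
  also have "\<dots> = l2_inner M f f - (l2_inner M f g)\<^sup>2 / l2_inner M g g"
    using False by (simp add: t_def power2_eq_square field_simps)
  finally show ?thesis
    using False l2_inner_self_nonneg[of M g] by (simp add: field_simps)
qed

lemma l2_Cauchy_Schwarz_abs:
  assumes "f \<in> l2_space M" "g \<in> l2_space M"
  shows "\<bar>l2_inner M f g\<bar> \<le> sqrt (l2_inner M f f) * sqrt (l2_inner M g g)"
  using real_sqrt_le_mono[OF l2_Cauchy_Schwarz[OF assms]] by (simp add: real_sqrt_mult)

lemma l2_inner_sum_sum:
  assumes u: "\<And>i. i \<in> I \<Longrightarrow> u i \<in> l2_space M"
  shows "l2_inner M (\<lambda>x. \<Sum>i\<in>I. c i * u i x) (\<lambda>x. \<Sum>i\<in>I. c i * u i x)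
    = (\<Sum>i\<in>I. \<Sum>j\<in>I. c i * c j * l2_inner M (u i) (u j))"
proof -
  have s: "(\<lambda>x. \<Sum>i\<in>I. c i * u i x) \<in> l2_space M" by (intro l2_sum l2_scale u)
  show ?thesis
    using u s
    by (subst l2_inner_sum_left)
       (auto simp: l2_scale l2_inner_scale_left l2_inner_sum_right l2_inner_scale_right
         sum_distrib_left mult.assoc intro!: sum.cong)
qed

text \<open>Let \<open>s\<close> be the sum on the left and \<open>w\<close> the combination of the
  \<open>u i\<close> with coefficients <v, u i>. Then <v, w> = s, while the bounds on the Gram
  matrix give <w, w> at most (1 + n delta) s. Cauchy-Schwarz bounds s^2 by <v, v> <w, w>, and one
  factor \<open>s\<close> cancels. For delta = 0 this is Bessel's inequality.\<close>

lemma almost_Bessel: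
  fixes n :: nat and \<delta> :: real
  assumes v: "v \<in> l2_space M" and u: "\<And>i. i < n \<Longrightarrow> u i \<in> l2_space M"
    and norm: "\<And>i. i < n \<Longrightarrow> l2_inner M (u i) (u i) \<le> 1"
    and orth: "\<And>i j. i < n \<Longrightarrow> j < n \<Longrightarrow> i \<noteq> j \<Longrightarrow> \<bar>l2_inner M (u i) (u j)\<bar> \<le> \<delta>"
    and "0 \<le> \<delta>"
  shows "(\<Sum>i<n. (l2_inner M v (u i))\<^sup>2) \<le> (1 + n * \<delta>) * l2_inner M v v"
proof -
  define c where "c i = l2_inner M v (u i)" for i
  define w where "w = (\<lambda>x. \<Sum>i<n. c i * u i x)"
  define s where "s = (\<Sum>i<n. (c i)\<^sup>2)"
  have w: "w \<in> l2_space M" unfolding w_def by (intro l2_sum l2_scale u) simp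
  have s0: "0 \<le> s" by (simp add: s_def sum_nonneg)
  have vw: "l2_inner M v w = s"
    unfolding w_def
    by (subst l2_inner_sum_right)
       (use u v in \<open>auto simp: l2_scale l2_inner_scale_right c_def s_def power2_eq_square\<close>)
  have "l2_inner M w w = (\<Sum>i<n. \<Sum>j<n. c i * c j * l2_inner M (u i) (u j))"
    unfolding w_def by (rule l2_inner_sum_sum) (use u in auto)
  \<comment> \<open>The delta term is granted on the diagonal as well, so that its double sum is
    exactly n delta s.\<close>
  also have "\<dots> \<le> (\<Sum>i<n. \<Sum>j<n. (if i = j then (c i)\<^sup>2 else 0) + \<delta> * (((c i)\<^sup>2 + (c j)\<^sup>2) / 2))"
  proof (intro sum_mono)
    fix i j assume ij: "i \<in> {..<n}" "j \<in> {..<n}"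
    show "c i * c j * l2_inner M (u i) (u j)
      \<le> (if i = j then (c i)\<^sup>2 else 0) + \<delta> * (((c i)\<^sup>2 + (c j)\<^sup>2) / 2)"
    proof (cases "i = j")
      case True
      have "(c i)\<^sup>2 * l2_inner M (u i) (u i) \<le> (c i)\<^sup>2 * 1"
        using ij norm by (intro mult_left_mono) auto
      moreover have "0 \<le> \<delta> * (c i)\<^sup>2" using \<open>0 \<le> \<delta>\<close> by simp
      ultimately show ?thesis using True by (simp add: power2_eq_square)
    next
      case False
      have "c i * c j * l2_inner M (u i) (u j) \<le> \<bar>c i * c j\<bar> * \<bar>l2_inner M (u i) (u j)\<bar>"
        by (metis abs_ge_self abs_mult)
      also have "\<dots> \<le> \<bar>c i * c j\<bar> * \<delta>"
        using ij False orth by (intro mult_left_mono) auto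
      also have "\<dots> \<le> ((c i)\<^sup>2 + (c j)\<^sup>2) / 2 * \<delta>"
      by (rule mult_right_mono[OF abs_mult_le_mean_squares \<open>0 \<le> \<delta>\<close>])
      finally show ?thesis using False by (simp add: mult.commute)
    qed
  qed
  also have "\<dots> = (1 + n * \<delta>) * s"
    by (simp add: sum.distrib s_def sum_distrib_left[symmetric] sum_divide_distrib[symmetric]
        sum_distrib_right algebra_simps)
  finally have ww: "l2_inner M w w \<le> (1 + n * \<delta>) * s" .
  have "s * s \<le> l2_inner M v v * l2_inner M w w"
    using l2_Cauchy_Schwarz[OF v w] by (simp add: vw power2_eq_square)
  also have "\<dots> \<le> l2_inner M v v * ((1 + n * \<delta>) * s)"
    by (rule mult_left_mono[OF ww]) simp
  finally have "s * s \<le> ((1 + n * \<delta>) * l2_inner M v v) * s" by (simp add: mult_ac)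
  then have "s \<le> (1 + n * \<delta>) * l2_inner M v v"
    using s0 \<open>0 \<le> \<delta>\<close> by (cases "s = 0") auto
  then show ?thesis by (simp add: s_def c_def)
qed

subsection \<open>Orthonormalisation and real sequences\<close>

lemma l2_independent_smaller:
  assumes "l2_independent M n f" "m \<le> n"
  shows "l2_independent M m f"
  unfolding l2_independent_def
proof (intro allI impI)
  fix c :: "nat \<Rightarrow> real" and i
  assume "AE x in M. (\<Sum>i<m. c i * f i x) = 0" and i: "i < m"
  moreover
  define c' where "c' i = (if i < m then c i else 0)" for i
  have "(\<Sum>i<n. c' i * f i x) = (\<Sum>i<m. c i * f i x)" for x
    using \<open>m \<le> n\<close> unfolding c'_def by (intro sum.mono_neutral_cong_right) auto
  ultimately have "AE x in M. (\<Sum>i<n. c' i * f i x) = 0" by simp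
  then have "\<forall>i<n. c' i = 0" using assms(1) unfolding l2_independent_def by blast
  then have "c' i = 0" using i \<open>m \<le> n\<close> by simp
  then show "c i = 0" using i by (simp add: c'_def)
qed

text \<open>Each \<open>e i\<close> is recorded as a combination of the \<open>f j\<close>, so that
  membership in any set closed under linear combinations, later an eigenspace, passes from
  \<open>f\<close> to \<open>e\<close>.\<close>

lemma l2_Gram_Schmidt:
  assumes "\<And>i. i < n \<Longrightarrow> f i \<in> l2_space M" "l2_independent M n f"
  obtains e where "\<And>i. i < n \<Longrightarrow> \<exists>c. e i = (\<lambda>x. \<Sum>j<n. c j * f j x)"
    and "\<And>i j. i < n \<Longrightarrow> j < n \<Longrightarrow> l2_inner M (e i) (e j) = (if i = j then 1 else 0)"
proof -
  have "\<exists>e. (\<forall>i<n. \<exists>c. e i = (\<lambda>x. \<Sum>j<n. c j * f j x)) \<and>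
      (\<forall>i<n. \<forall>j<n. l2_inner M (e i) (e j) = (if i = j then 1 else 0))"
    using assms
  proof (induction n)
    case 0
    show ?case by simp
  next
    case (Suc n)
    have "l2_independent M n f" using l2_independent_smaller[OF Suc.prems(2)] by simp
    with Suc.IH Suc.prems(1) obtain e
      where "\<forall>i<n. \<exists>c. e i = (\<lambda>x. \<Sum>j<n. c j * f j x)"
        and orth: "\<And>i j. i < n \<Longrightarrow> j < n \<Longrightarrow> l2_inner M (e i) (e j) = (if i = j then 1 else 0)"
      by (metis less_SucI)
    then obtain C where e: "\<And>i. i < n \<Longrightarrow> e i = (\<lambda>x. \<Sum>j<n. C i j * f j x)" by metis
    have f: "f i \<in> l2_space M" if "i \<le> n" for i using Suc.prems(1) that by simp
    have e_l2: "e i \<in> l2_space M" if "i < n" for i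
      unfolding e[OF that] by (intro l2_sum l2_scale f) simp
    define p where "p = (\<lambda>x. \<Sum>i<n. l2_inner M (f n) (e i) * e i x)"
    define w where "w = (\<lambda>x. f n x - p x)"
    \<comment> \<open>The coefficients of \<open>w\<close> in terms of the \<open>f j\<close>. The
      last one is 1, so independence prevents \<open>w\<close> from vanishing almost everywhere and
      it can be normalised.\<close>
    define d where "d j = (if j = n then 1 else - (\<Sum>i<n. l2_inner M (f n) (e i) * C i j))" for j
    have p: "p \<in> l2_space M" unfolding p_def by (intro l2_sum l2_scale e_l2) simp
    have w: "w \<in> l2_space M" unfolding w_def by (intro l2_diff p f) simp
    have w_eq: "w = (\<lambda>x. \<Sum>j<Suc n. d j * f j x)"
    proof
      fix x
      have "p x = (\<Sum>i<n. \<Sum>j<n. l2_inner M (f n) (e i) * C i j * f j x)"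
        unfolding p_def by (intro sum.cong) (auto simp: e sum_distrib_left mult.assoc)
      also have "\<dots> = (\<Sum>j<n. \<Sum>i<n. l2_inner M (f n) (e i) * C i j * f j x)" by (rule sum.swap)
      also have "\<dots> = - (\<Sum>j<n. d j * f j x)"
        by (auto simp: d_def sum_distrib_right sum_negf[symmetric] intro!: sum.cong)
      finally show "w x = (\<Sum>j<Suc n. d j * f j x)" by (simp add: w_def d_def)
    qed
    have "l2_inner M w w \<noteq> 0"
    proof
      assume "l2_inner M w w = 0"
      then have "AE x in M. (\<Sum>j<Suc n. d j * f j x) = 0"
        using l2_inner_self_eq_0_iff[OF w] by (simp add: w_eq)
      then have "d n = 0" using Suc.prems(2) unfolding l2_independent_def by blast
      then show False by (simp add: d_def)
    qed
    then have ww: "l2_inner M w w > 0" using l2_inner_self_nonneg[of M w] by linarith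
    have we: "l2_inner M w (e j) = 0" if "j < n" for j
    proof -
      have "l2_inner M p (e j) = (\<Sum>i<n. if i = j then l2_inner M (f n) (e i) else 0)"
        unfolding p_def
        by (subst l2_inner_sum_left)
           (use that in \<open>auto simp: l2_scale e_l2 l2_inner_scale_left orth if_distrib cong: if_cong intro!: sum.cong\<close>)
      also have "\<dots> = l2_inner M (f n) (e j)" using that by simp
      finally show ?thesis
        unfolding w_def using l2_inner_diff_left[OF f p e_l2[OF that]] by simp
    qed
    define a where "a = 1 / sqrt (l2_inner M w w)"
    have aa: "a * (a * l2_inner M w w) = 1"
      using ww by (simp add: a_def field_simps)
    define e' where "e' = e(n := (\<lambda>x. a * w x))"
    have "\<exists>c. e' i = (\<lambda>x. \<Sum>j<Suc n. c j * f j x)" if "i < Suc n" for i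
    proof (cases "i = n")
      case True
      have "e' i = (\<lambda>x. \<Sum>j<Suc n. (a * d j) * f j x)"
        unfolding e'_def using True by (simp add: w_eq sum_distrib_left distrib_left mult.assoc)
      then show ?thesis by (rule exI[of _ "\<lambda>j. a * d j"])
    next
      case False
      then have "e' i = (\<lambda>x. \<Sum>j<Suc n. (if j < n then C i j else 0) * f j x)"
        using that by (auto simp: e'_def e)
      then show ?thesis by (rule exI[of _ "\<lambda>j. if j < n then C i j else 0"])
    qed
    moreover have "l2_inner M (e' i) (e' j) = (if i = j then 1 else 0)"
      if "i < Suc n" "j < Suc n" for i j
      using that orth[of i j] we[of i] we[of j] l2_inner_commute[of M "e i" w] aa
      by (auto simp: e'_def l2_inner_scale_left l2_inner_scale_right less_Suc_eq)
    ultimately show ?case by blast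
  qed
  then show thesis using that by metis
qed

section \<open>Enumerations and growth rates of real sequences\<close>

text \<open>Each positive number \<open>t\<close> is repeated \<open>m t\<close> times; \<open>c t\<close> counts the terms that are at least \<open>t\<close>.\<close>

lemma decreasing_enumeration_exists:
  fixes m :: "real \<Rightarrow> nat"
  assumes fin: "\<And>t. 0 < t \<Longrightarrow> finite {s. t \<le> s \<and> m s > 0}"
  obtains lam :: "nat \<Rightarrow> real" where "\<And>l. 0 \<le> lam l" "\<And>l. lam (Suc l) \<le> lam l"
    "\<And>t. 0 < t \<Longrightarrow> finite {l. 1 \<le> l \<and> lam l = t}"
    "\<And>t. 0 < t \<Longrightarrow> card {l. 1 \<le> l \<and> lam l = t} = m t"
proof -
  define c where "c t = (\<Sum>s | t \<le> s \<and> m s > 0. m s)" for t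
  \<comment> \<open>A value \<open>t\<close> belongs to \<open>S l\<close> when at least
    \<open>l\<close> terms of the list should be \<open>t\<close> or larger; the \<open>l\<close>-th
    term is therefore the greatest such value.\<close>
  define S where "S l = {t. 0 < t \<and> m t > 0 \<and> l \<le> c t}" for l
  define lam where "lam l = (if S l = {} then 0 else (GREATEST t. t \<in> S l))" for l
  have c_antimono: "c t \<le> c s" if "0 < s" "s \<le> t" for s t
    unfolding c_def using fin[OF that(1)] that by (intro sum_mono2) auto
  have greatest: "lam l \<in> S l \<and> (\<forall>t\<in>S l. t \<le> lam l)" if ne: "S l \<noteq> {}" for l
  proof -
    obtain t0 where t0: "t0 \<in> S l" using ne by blast
    \<comment> \<open>\<open>S l\<close> may accumulate at 0, but only finitely many of its members
      lie above a given \<open>t0\<close>, so a greatest one exists.\<close>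
    define F where "F = {t \<in> S l. t0 \<le> t}"
    have "finite F" by (rule finite_subset[of _ "{s. t0 \<le> s \<and> m s > 0}"])
      (use t0 fin[of t0] in \<open>auto simp: F_def S_def\<close>)
    moreover have "t0 \<in> F" using t0 by (simp add: F_def)
    ultimately have "Max F \<in> F" "\<forall>t\<in>F. t \<le> Max F" by (auto intro: Max_in)
    then have M: "Max F \<in> S l" "\<forall>t\<in>S l. t \<le> Max F"
      by (auto simp: F_def)
    then have "(GREATEST t. t \<in> S l) = Max F" by (intro Greatest_equality) auto
    then show ?thesis using M ne by (simp add: lam_def)
  qed
  have pos: "0 < lam l" if "S l \<noteq> {}" for l using greatest[OF that] by (simp add: S_def)
  have nonneg: "0 \<le> lam l" for l
    using pos[of l] by (cases "S l = {}") (auto simp: lam_def)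
  have mono: "lam (Suc l) \<le> lam l" for l
  proof (cases "S (Suc l) = {}")
    case True
    then show ?thesis using nonneg[of l] by (simp add: lam_def)
  next
    case False
    then have "lam (Suc l) \<in> S l" using greatest[of "Suc l"] by (simp add: S_def)
    then show ?thesis using greatest[of l] by blast
  qed
  \<comment> \<open>The terms equal to \<open>t\<close> occupy the block of \<open>m t\<close>
    positions directly after the \<open>d\<close> positions taken by larger values.\<close>
  have level: "\<exists>d. {l. 1 \<le> l \<and> lam l = t} = {d<..d + m t}" if t: "0 < t" for t
  proof (cases "m t = 0")
    case True
    have "lam l \<noteq> t" for l
    proof (cases "S l = {}")
      case True
      then show ?thesis using t by (simp add: lam_def)
    next
      case False
      then have "m (lam l) > 0" using greatest by (simp add: S_def)
      then show ?thesis using \<open>m t = 0\<close> by auto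
    qed
    then have "{l. 1 \<le> l \<and> lam l = t} = {}" by simp
    then show ?thesis using True by simp
  next
    case False
    define d where "d = (\<Sum>s | t < s \<and> m s > 0. m s)"
    have fin': "finite {s. t < s \<and> m s > 0}"
      using fin[OF t] by (rule rev_finite_subset) auto
    have "{s. t \<le> s \<and> m s > 0} = insert t {s. t < s \<and> m s > 0}"
      using False by auto
    then have ct: "c t = d + m t" unfolding c_def d_def using fin' by simp
    have cs: "c s \<le> d" if "t < s" for s
      unfolding c_def d_def using fin' that by (intro sum_mono2) auto
    have lam_eq: "lam l = t \<longleftrightarrow> d < l \<and> l \<le> d + m t" if l: "1 \<le> l" for l
    proof
      assume lt: "lam l = t"
      then have ne: "S l \<noteq> {}" using t by (auto simp: lam_def split: if_splits)
      have "l \<le> c t" using greatest[OF ne] lt by (simp add: S_def)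
      moreover have "d < l"
      proof (rule ccontr)
        assume "\<not> d < l"
        then have "l \<le> d" by simp
        with l have "d \<noteq> 0" by simp
        then have ne': "{s. t < s \<and> m s > 0} \<noteq> {}" unfolding d_def by (metis sum.empty)
        \<comment> \<open>If \<open>l\<close> were at most \<open>d\<close>, the least value
          \<open>s\<close> above \<open>t\<close> would satisfy \<open>c s = d\<close> and hence lie
          in \<open>S l\<close>, although \<open>t\<close> is the greatest element there.\<close>
        define s where "s = Min {s. t < s \<and> m s > 0}"
        have s: "t < s" "m s > 0" using Min_in[OF fin' ne'] by (auto simp: s_def)
        have "{s. t < s \<and> m s > 0} = {r. s \<le> r \<and> m r > 0}"
          using s Min_le[OF fin'] by (auto simp: s_def[symmetric])
        then have "c s = d" by (simp add: c_def d_def)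
        then have "s \<in> S l" using s t \<open>l \<le> d\<close> by (simp add: S_def)
        then show False using greatest[OF ne] lt s by force
      qed
      ultimately show "d < l \<and> l \<le> d + m t" using ct by simp
    next
      assume d: "d < l \<and> l \<le> d + m t"
      then have tS: "t \<in> S l" using t False ct by (simp add: S_def)
      then have g: "lam l \<in> S l" "t \<le> lam l" using greatest[of l] by auto
      have "\<not> t < lam l"
        using cs[of "lam l"] g(1) d by (auto simp: S_def)
      then show "lam l = t" using g(2) by simp
    qed
    have "{l. 1 \<le> l \<and> lam l = t} = {l. 1 \<le> l \<and> d < l \<and> l \<le> d + m t}"
      by (rule Collect_cong) (use lam_eq in blast)
    also have "\<dots> = {d<..d + m t}" by auto
    finally show ?thesis by (rule exI)
  qed
  show thesis
  proof (rule that[of lam, OF nonneg mono])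
    fix t :: real assume "0 < t"
    then obtain d where "{l. 1 \<le> l \<and> lam l = t} = {d<..d + m t}" using level by blast
    then show "finite {l. 1 \<le> l \<and> lam l = t}" "card {l. 1 \<le> l \<and> lam l = t} = m t"
      by simp_all
  qed
qed

text \<open>Log-convexity says that consecutive ratios increase, and it propagates positivity from
  the first two terms. A bound on the ratios at even indices then bounds all of them. In the
  application \<open>a n\<close> is <A^n f, f>, and at even indices the ratio is the Rayleigh
  quotient of an iterate.\<close>

lemma log_convex_growth_rate:
  fixes a :: "nat \<Rightarrow> real"
  assumes pos: "0 < a 0" "0 < a 1" and nonneg: "\<And>n. 0 \<le> a n"
    and convex: "\<And>n. (a (Suc n))\<^sup>2 \<le> a n * a (Suc (Suc n))"
    and bound: "\<And>n. a (Suc (2 * n)) \<le> C * a (2 * n)"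
  obtains r where "0 < r" "a 1 / a 0 \<le> r" "\<And>n. 0 < a n"
    "\<And>n. a 1 / a 0 \<le> a (Suc n) / a n"
    "\<And>n. a (Suc n) / a n \<le> r" "(\<lambda>n. a (Suc n) / a n) \<longlonglongrightarrow> r"
proof -
  have a: "0 < a n \<and> 0 < a (Suc n)" for n
  proof (induction n)
    case (Suc n)
    then have "0 < a n * a (Suc (Suc n))"
      using convex[of n] by (meson order_less_le_trans zero_less_power)
    then show ?case using Suc by (simp add: zero_less_mult_iff)
  qed (use pos in simp)
  define q where "q n = a (Suc n) / a n" for n
  have inc: "incseq q"
  proof (rule incseq_SucI)
    fix n
    show "q n \<le> q (Suc n)"
      using a[of n] a[of "Suc n"] convex[of n]
      by (simp add: q_def divide_simps power2_eq_square mult.commute)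
  qed
  have "q n \<le> C" for n
  proof -
    have "q n \<le> q (2 * n)" by (rule incseqD[OF inc]) simp
    also have "\<dots> \<le> C" using a[of "2 * n"] bound[of n] by (simp add: q_def divide_simps)
    finally show ?thesis .
  qed
  then obtain r where r: "q \<longlonglongrightarrow> r" and le: "\<forall>n. q n \<le> r"
    using incseq_convergent[OF inc, of C] by blast
  have q0: "q 0 \<le> q n" for n by (rule incseqD[OF inc]) simp
  have "0 < q 0" using a[of 0] by (simp add: q_def)
  then have "0 < r" using le by (meson order_less_le_trans)
  show thesis
    using that[OF \<open>0 < r\<close>] a le q0 r unfolding q_def by simp
qed

subsection \<open>Hilbert-Schmidt operators\<close>

locale l2_kernel = pair_sigma_finite M N
  for M :: "'a measure" and N :: "'b measure" +
  fixes k :: "'a \<Rightarrow> 'b \<Rightarrow> real"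
  assumes k_l2: "(\<lambda>(x, y). k x y) \<in> l2_space (M \<Otimes>\<^sub>M N)"
begin

text \<open>The square of the Hilbert-Schmidt norm of the operator with kernel
  \<open>k\<close>.\<close>

definition hs :: real where
  "hs = (\<integral>y. \<integral>x. (k x y)\<^sup>2 \<partial>M \<partial>N)"

lemma measurable_k [measurable]: "(\<lambda>(x, y). k x y) \<in> borel_measurable (M \<Otimes>\<^sub>M N)"
  using k_l2 by (rule l2_spaceD)

lemma integrable_k_square: "integrable (M \<Otimes>\<^sub>M N) (\<lambda>(x, y). (k x y)\<^sup>2)"
  using l2_spaceD(2)[OF k_l2] by (simp add: case_prod_unfold)

lemma section_l2: "AE y in N. (\<lambda>x. k x y) \<in> l2_space M"
  using AE_integrable_snd[OF integrable_k_square] AE_space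
proof eventually_elim
  case (elim y)
  then show ?case by (auto simp: l2_space_def)
qed

text \<open>This form allows Cauchy-Schwarz and Bessel to be applied to the section of the kernel at
  almost every fixed \<open>y\<close> and then integrated over \<open>y\<close>.\<close>

lemma kernel_op_eq_inner: "kernel_op M k f y = l2_inner M (\<lambda>x. k x y) f"
  by (simp add: kernel_op_def l2_inner_def)

lemma measurable_kernel_op:
  assumes [measurable]: "f \<in> borel_measurable M"
  shows "kernel_op M k f \<in> borel_measurable N"
  unfolding kernel_op_def
  by measurable

lemma integrable_section_norm: "integrable N (\<lambda>y. l2_inner M (\<lambda>x. k x y) (\<lambda>x. k x y))"
  unfolding l2_inner_def using integrable_snd[OF integrable_k_square]
  by (simp add: power2_eq_square)

lemma hs_eq: "hs = (\<integral>y. l2_inner M (\<lambda>x. k x y) (\<lambda>x. k x y) \<partial>N)"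
  by (simp add: hs_def l2_inner_def power2_eq_square)

lemma kernel_op_bound:
  assumes "f \<in> l2_space M"
  shows "AE y in N. (kernel_op M k f y)\<^sup>2
    \<le> l2_inner M (\<lambda>x. k x y) (\<lambda>x. k x y) * l2_inner M f f"
  using section_l2
  by eventually_elim (simp add: kernel_op_eq_inner l2_Cauchy_Schwarz assms)

lemma kernel_op_l2:
  assumes f: "f \<in> l2_space M"
  shows "kernel_op M k f \<in> l2_space N"
proof -
  have m: "kernel_op M k f \<in> borel_measurable N"
    using l2_spaceD(1)[OF f] by (rule measurable_kernel_op)
  have "integrable N (\<lambda>y. (kernel_op M k f y)\<^sup>2)"
  proof (rule Bochner_Integration.integrable_bound)
    show "integrable N (\<lambda>y. l2_inner M (\<lambda>x. k x y) (\<lambda>x. k x y) * l2_inner M f f)"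
      by (intro integrable_mult_left integrable_section_norm)
    show "(\<lambda>y. (kernel_op M k f y)\<^sup>2) \<in> borel_measurable N" using m by simp
    show "AE y in N. norm ((kernel_op M k f y)\<^sup>2)
        \<le> norm (l2_inner M (\<lambda>x. k x y) (\<lambda>x. k x y) * l2_inner M f f)"
      using kernel_op_bound[OF f] by eventually_elim (simp add: abs_mult)
  qed
  with m show ?thesis by (simp add: l2_space_def)
qed

section \<open>The transposed kernel as adjoint, and the Hilbert-Schmidt bound\<close>

lemma integrable_kernel_mult:
  assumes f: "f \<in> l2_space M" and g: "g \<in> l2_space N"
  shows "integrable (M \<Otimes>\<^sub>M N) (\<lambda>(x, y). k x y * (f x * g y))"
proof -
  have [measurable]: "f \<in> borel_measurable M" "g \<in> borel_measurable N"
    using f g by (auto dest: l2_spaceD)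
  have "integrable (M \<Otimes>\<^sub>M N) (\<lambda>(x, y). (f x)\<^sup>2 * (g y)\<^sup>2)"
    using f g by (intro Fubini_integrable) (auto dest: l2_spaceD simp: abs_mult)
  then have "(\<lambda>(x, y). f x * g y) \<in> l2_space (M \<Otimes>\<^sub>M N)"
    by (simp add: l2_space_def case_prod_unfold power_mult_distrib)
  from integrable_l2_mult[OF k_l2 this] show ?thesis by (simp add: case_prod_unfold)
qed

lemma inner_kernel_op:
  "l2_inner N (kernel_op M k f) g = (\<integral>y. \<integral>x. k x y * (f x * g y) \<partial>M \<partial>N)"
  unfolding l2_inner_def kernel_op_def
  by (simp add: mult.assoc flip: integral_mult_left_zero)

lemma l2_kernel_swap: "l2_kernel N M (\<lambda>y x. k x y)"
proof -
  interpret Q: pair_sigma_finite N M ..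
  show ?thesis
  proof
    have "integrable (N \<Otimes>\<^sub>M M) (\<lambda>(y, x). (k x y)\<^sup>2)"
      using integrable_product_swap[OF integrable_k_square] by simp
    moreover have "(\<lambda>(y, x). k x y) \<in> borel_measurable (N \<Otimes>\<^sub>M M)"
      using measurable_pair_swap[OF measurable_k] by simp
    ultimately show "(\<lambda>(y, x). k x y) \<in> l2_space (N \<Otimes>\<^sub>M M)"
      by (simp add: l2_space_def case_prod_unfold)
  qed
qed

text \<open>Fubini for k(x,y) f(x) g(y). It also supplies the witness that gives the choice in
  \<open>l2_adjoint\<close> its defining property.\<close>

lemma is_l2_adjoint_swap:
  "is_l2_adjoint M N (kernel_op M k) (kernel_op N (\<lambda>y x. k x y))"
proof -
  interpret Q: l2_kernel N M "\<lambda>y x. k x y" by (rule l2_kernel_swap)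
  show ?thesis
    unfolding is_l2_adjoint_def
  proof (intro ballI conjI)
    fix g assume g: "g \<in> l2_space N"
    show "kernel_op N (\<lambda>y x. k x y) g \<in> l2_space M" using g by (rule Q.kernel_op_l2)
    fix f assume f: "f \<in> l2_space M"
    have "l2_inner M f (kernel_op N (\<lambda>y x. k x y) g)
        = (\<integral>x. \<integral>y. k x y * (f x * g y) \<partial>N \<partial>M)"
      by (subst l2_inner_commute) (simp add: Q.inner_kernel_op mult.commute)
    also have "\<dots> = (\<integral>y. \<integral>x. k x y * (f x * g y) \<partial>M \<partial>N)"
      using integrable_kernel_mult[OF f g] by (simp add: Fubini_integral)
    finally show "l2_inner N (kernel_op M k f) g = l2_inner M f (kernel_op N (\<lambda>y x. k x y) g)"
      by (simp add: inner_kernel_op)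
  qed
qed

text \<open>\<open>almost_Bessel\<close> for the section of \<open>k\<close> at almost every
  \<open>y\<close>, integrated over \<open>y\<close>. It takes the place of compactness: a large
  almost orthonormal family cannot have all its images bounded below in norm.\<close>

lemma Hilbert_Schmidt_bound:
  fixes n :: nat and \<delta> :: real
  assumes u: "\<And>i. i < n \<Longrightarrow> u i \<in> l2_space M"
    and norm: "\<And>i. i < n \<Longrightarrow> l2_inner M (u i) (u i) \<le> 1"
    and orth: "\<And>i j. i < n \<Longrightarrow> j < n \<Longrightarrow> i \<noteq> j \<Longrightarrow> \<bar>l2_inner M (u i) (u j)\<bar> \<le> \<delta>"
    and "0 \<le> \<delta>"
  shows "(\<Sum>i<n. l2_inner N (kernel_op M k (u i)) (kernel_op M k (u i))) \<le> (1 + n * \<delta>) * hs"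
proof -
  have int: "integrable N (\<lambda>y. (kernel_op M k (u i) y)\<^sup>2)" if "i < n" for i
    using l2_spaceD(2)[OF kernel_op_l2[OF u[OF that]]] .
  have "(\<Sum>i<n. l2_inner N (kernel_op M k (u i)) (kernel_op M k (u i)))
      = (\<integral>y. (\<Sum>i<n. (kernel_op M k (u i) y)\<^sup>2) \<partial>N)"
    using int by (simp add: l2_inner_def power2_eq_square)
  also have "\<dots> \<le> (\<integral>y. (1 + n * \<delta>) * l2_inner M (\<lambda>x. k x y) (\<lambda>x. k x y) \<partial>N)"
  proof (rule integral_mono_AE)
    show "integrable N (\<lambda>y. \<Sum>i<n. (kernel_op M k (u i) y)\<^sup>2)" using int by auto
    show "integrable N (\<lambda>y. (1 + n * \<delta>) * l2_inner M (\<lambda>x. k x y) (\<lambda>x. k x y))"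
      by (intro integrable_mult_right integrable_section_norm)
    show "AE y in N. (\<Sum>i<n. (kernel_op M k (u i) y)\<^sup>2)
        \<le> (1 + n * \<delta>) * l2_inner M (\<lambda>x. k x y) (\<lambda>x. k x y)"
      using section_l2
      by eventually_elim (use u norm orth \<open>0 \<le> \<delta>\<close> in
          \<open>auto simp: kernel_op_eq_inner intro!: almost_Bessel\<close>)
  qed
  also have "\<dots> = (1 + n * \<delta>) * hs" by (simp add: hs_eq)
  finally show ?thesis .
qed

end

subsection \<open>Enumeration of the eigenvalues\<close>

lemma l2_multiplicity_ge:
  assumes "\<And>i. i < n \<Longrightarrow> f i \<in> l2_eigenspace M A t" "l2_independent M n f"
  shows "enat n \<le> l2_multiplicity M A t"
  unfolding l2_multiplicity_def l2_dim_def by (rule Sup_upper) (use assms in blast)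

text \<open>\<open>T\<close> is any representative of the adjoint, so that the operator selected by
  \<open>l2_adjoint\<close> can be substituted for it.\<close>

locale l2_kernel_adjoint = l2_kernel M N k
  for M :: "'a measure" and N :: "'b measure" and k +
  fixes T :: "('b \<Rightarrow> real) \<Rightarrow> 'a \<Rightarrow> real"
  assumes adjoint: "is_l2_adjoint M N (kernel_op M k) T"
begin

abbreviation A :: "('a \<Rightarrow> real) \<Rightarrow> 'a \<Rightarrow> real" where
  "A \<equiv> T \<circ> kernel_op M k"

lemma A_l2: "f \<in> l2_space M \<Longrightarrow> A f \<in> l2_space M"
  using adjoint kernel_op_l2 by (auto simp: is_l2_adjoint_def)

lemma A_inner:
  assumes "f \<in> l2_space M" "g \<in> l2_space M"
  shows "l2_inner M (A f) g = l2_inner N (kernel_op M k f) (kernel_op M k g)"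
proof -
  have "l2_inner N (kernel_op M k g) (kernel_op M k f) = l2_inner M g (A f)"
    using adjoint assms kernel_op_l2 by (simp add: is_l2_adjoint_def)
  then show ?thesis by (simp only: l2_inner_commute[of N] l2_inner_commute[of M])
qed

lemma A_sym:
  assumes "f \<in> l2_space M" "g \<in> l2_space M"
  shows "l2_inner M (A f) g = l2_inner M f (A g)"
  using A_inner[OF assms] A_inner[OF assms(2,1)] by (simp only: l2_inner_commute)

text \<open>Symmetry moves \<open>A\<close> to the test function, and \<open>l2_AE_eqI\<close> leads
  back. As \<open>T\<close> is determined only up to null sets, the weak form is convenient: it is
  visibly linear in \<open>f\<close> and passes to limits of inner products.\<close>

lemma eigenspace_iff:
  "f \<in> l2_eigenspace M A t \<longleftrightarrow>
    f \<in> l2_space M \<and> (\<forall>h\<in>l2_space M. l2_inner M f (A h) = t * l2_inner M f h)"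
proof (intro iffI conjI ballI; (elim conjE)?)
  assume f: "f \<in> l2_eigenspace M A t"
  then show f2: "f \<in> l2_space M" by (simp add: l2_eigenspace_def)
  fix h assume h: "h \<in> l2_space M"
  have "l2_inner M (A f) h = l2_inner M (\<lambda>x. t * f x) h"
    using f by (intro l2_inner_cong_AE l2_spaceD h A_l2 l2_scale f2) (simp add: l2_eigenspace_def)
  then show "l2_inner M f (A h) = t * l2_inner M f h"
    using A_sym[OF f2 h] by (simp add: l2_inner_scale_left)
next
  assume f: "f \<in> l2_space M" and eq: "\<forall>h\<in>l2_space M. l2_inner M f (A h) = t * l2_inner M f h"
  have "AE x in M. A f x = t * f x"
    by (intro l2_AE_eqI A_l2 l2_scale f) (use eq f A_sym in \<open>simp add: l2_inner_scale_left\<close>)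
  then show "f \<in> l2_eigenspace M A t" using f by (simp add: l2_eigenspace_def)
qed

lemma eigenspace_sum:
  assumes f: "\<And>i. i < n \<Longrightarrow> f i \<in> l2_eigenspace M A t"
  shows "(\<lambda>x. \<Sum>i<(n::nat). c i * f i x) \<in> l2_eigenspace M A t"
proof -
  have f': "f i \<in> l2_space M" if "i < n" for i using f[OF that] by (simp add: l2_eigenspace_def)
  have "l2_inner M (\<lambda>x. \<Sum>i<n. c i * f i x) (A h) = t * l2_inner M (\<lambda>x. \<Sum>i<n. c i * f i x) h"
    if h: "h \<in> l2_space M" for h
  proof -
    have "l2_inner M (\<lambda>x. \<Sum>i<n. c i * f i x) (A h) = (\<Sum>i<n. c i * l2_inner M (f i) (A h))"
      by (subst l2_inner_sum_left) (use f' A_l2[OF h] in \<open>auto simp: l2_scale l2_inner_scale_left\<close>)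
    also have "\<dots> = t * (\<Sum>i<n. c i * l2_inner M (f i) h)"
      using f h by (auto simp: eigenspace_iff sum_distrib_left intro!: sum.cong)
    also have "(\<Sum>i<n. c i * l2_inner M (f i) h) = l2_inner M (\<lambda>x. \<Sum>i<n. c i * f i x) h"
      by (subst l2_inner_sum_left) (use f' h in \<open>auto simp: l2_scale l2_inner_scale_left\<close>)
    finally show ?thesis .
  qed
  moreover have "(\<lambda>x. \<Sum>i<n. c i * f i x) \<in> l2_space M" by (intro l2_sum l2_scale f') simp
  ultimately show ?thesis unfolding eigenspace_iff by blast
qed

lemma eigenspace_orthogonal:
  assumes f: "f \<in> l2_eigenspace M A s" and g: "g \<in> l2_eigenspace M A t" and "s \<noteq> t"
  shows "l2_inner M f g = 0"
proof -
  have f': "f \<in> l2_space M" and g': "g \<in> l2_space M" using f g by (auto simp: l2_eigenspace_def)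
  have "l2_inner M f (A g) = s * l2_inner M f g" using f g' by (simp add: eigenspace_iff)
  moreover have "l2_inner M g (A f) = t * l2_inner M g f" using g f' by (simp add: eigenspace_iff)
  moreover have "l2_inner M f (A g) = l2_inner M g (A f)"
    using A_sym[OF f' g'] l2_inner_commute by metis
  ultimately have "s * l2_inner M f g = t * l2_inner M f g" by (simp only: l2_inner_commute)
  then show ?thesis using \<open>s \<noteq> t\<close> by simp
qed

lemma eigenspace_norm_kernel_op:
  assumes f: "f \<in> l2_eigenspace M A t"
  shows "l2_inner N (kernel_op M k f) (kernel_op M k f) = t * l2_inner M f f"
proof -
  have f': "f \<in> l2_space M" using f by (simp add: l2_eigenspace_def)
  have "l2_inner M f (A f) = t * l2_inner M f f" using f f' by (simp add: eigenspace_iff)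
  then show ?thesis using A_inner[OF f' f'] A_sym[OF f' f'] by simp
qed

text \<open>Gram-Schmidt inside each eigenspace and orthogonality between different ones yield an
  orthonormal family with as many members as the total multiplicity. Each member has an image of
  squared norm \<open>t\<close>, at least \<open>\<epsilon>\<close>, so the Hilbert-Schmidt bound
  with delta = 0 applies.\<close>

lemma eigenvalue_count:
  assumes F: "finite F" "\<And>t. t \<in> F \<Longrightarrow> \<epsilon> \<le> t" and "0 < \<epsilon>"
    and f: "\<And>t i. t \<in> F \<Longrightarrow> i < m t \<Longrightarrow> f t i \<in> l2_eigenspace M A t"
    and ind: "\<And>t. t \<in> F \<Longrightarrow> l2_independent M (m t) (f t)"
  shows "\<epsilon> * real (\<Sum>t\<in>F. m t) \<le> hs"
proof -
  have "\<exists>e. \<forall>i<m t. e i \<in> l2_eigenspace M A t \<and>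
      (\<forall>j<m t. l2_inner M (e i) (e j) = (if i = j then 1 else 0))" if t: "t \<in> F" for t
  proof -
    have l2: "f t i \<in> l2_space M" if "i < m t" for i
      using f[OF t that] by (simp add: l2_eigenspace_def)
    obtain e where e: "\<And>i. i < m t \<Longrightarrow> \<exists>c. e i = (\<lambda>x. \<Sum>j<m t. c j * f t j x)"
      and orth: "\<And>i j. i < m t \<Longrightarrow> j < m t \<Longrightarrow> l2_inner M (e i) (e j) = (if i = j then 1 else 0)"
      using l2_Gram_Schmidt[of "m t" "f t" M, OF l2 ind[OF t]] by blast
    have "e i \<in> l2_eigenspace M A t" if i: "i < m t" for i
    proof -
      obtain c where "e i = (\<lambda>x. \<Sum>j<m t. c j * f t j x)" using e[OF i] by blast
      then show ?thesis using eigenspace_sum[of "m t" "f t" t c] f[OF t] by simp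
    qed
    then show ?thesis using orth by blast
  qed
  then obtain e where e: "\<And>t i. t \<in> F \<Longrightarrow> i < m t \<Longrightarrow> e t i \<in> l2_eigenspace M A t"
    and orth: "\<And>t i j. t \<in> F \<Longrightarrow> i < m t \<Longrightarrow> j < m t \<Longrightarrow>
      l2_inner M (e t i) (e t j) = (if i = j then 1 else 0)"
    by metis
  define n where "n = (\<Sum>t\<in>F. m t)"
  \<comment> \<open>The family is doubly indexed, by eigenvalue and position; the bijection
    \<open>h\<close> lists it as a single sequence.\<close>
  define I where "I = (SIGMA t:F. {..<m t})"
  have "finite I" "card I = n" using F(1) by (auto simp: I_def n_def)
  then obtain h where h: "bij_betw h {..<n} I"
    using ex_bij_betw_nat_finite[of I] by (auto simp: atLeast0LessThan)
  define u where "u i = e (fst (h i)) (snd (h i))" for i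
  have hI: "fst (h i) \<in> F \<and> snd (h i) < m (fst (h i))" if "i < n" for i
    using bij_betwE[OF h] that by (force simp: I_def)
  have u: "u i \<in> l2_eigenspace M A (fst (h i))" if "i < n" for i
    using hI[OF that] e by (simp add: u_def)
  have norm: "l2_inner M (u i) (u i) = 1" if "i < n" for i
    using hI[OF that] orth by (simp add: u_def)
  have orth_u: "l2_inner M (u i) (u j) = 0" if ij: "i < n" "j < n" "i \<noteq> j" for i j
  proof (cases "fst (h i) = fst (h j)")
    case True
    have "h i \<noteq> h j" using h ij by (auto simp: bij_betw_def inj_on_def)
    then have "snd (h i) \<noteq> snd (h j)" using True by (simp add: prod_eq_iff)
    then show ?thesis using True hI[OF ij(1)] hI[OF ij(2)] orth by (simp add: u_def)
  next
    case False
    then show ?thesis using u ij eigenspace_orthogonal by blast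
  qed
  have "\<epsilon> * real n = (\<Sum>i<n. \<epsilon>)" by simp
  also have "\<dots> \<le> (\<Sum>i<n. l2_inner N (kernel_op M k (u i)) (kernel_op M k (u i)))"
    by (rule sum_mono) (use eigenspace_norm_kernel_op[OF u] norm F(2) hI in simp)
  also have "\<dots> \<le> (1 + real n * 0) * hs"
    by (rule Hilbert_Schmidt_bound) (use u norm orth_u in \<open>auto simp: l2_eigenspace_def\<close>)
  finally show ?thesis by (simp add: n_def)
qed

text \<open>By \<open>eigenvalue_count\<close> an independent family in the eigenspace has at most
  \<open>hs / t\<close> members, so the supremum defining the dimension is finite and
  attained.\<close>

lemma l2_multiplicity_witness:
  assumes t: "0 < t"
  obtains n f where "l2_multiplicity M A t = enat n"
    "\<And>i. i < n \<Longrightarrow> f i \<in> l2_eigenspace M A t" "l2_independent M n f"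
proof -
  define P where "P = {n. \<exists>f. (\<forall>i<n. f i \<in> l2_eigenspace M A t) \<and> l2_independent M n f}"
  have "t * real n \<le> hs" if n: "n \<in> P" for n
  proof -
    obtain f where "\<forall>i<n. f i \<in> l2_eigenspace M A t" "l2_independent M n f"
      using n unfolding P_def by blast
    then show ?thesis using eigenvalue_count[of "{t}" t "\<lambda>_. n" "\<lambda>_. f"] t by simp
  qed
  then have "real n \<le> hs / t" if n: "n \<in> P" for n using n t by (simp add: field_simps)
  then have "P \<subseteq> {..nat \<lfloor>hs / t\<rfloor>}" by (auto simp: le_nat_floor)
  then have fin: "finite P" by (rule finite_subset) simp
  have "0 \<in> P" by (auto simp: P_def l2_independent_def)
  then have M: "Max P \<in> P" using fin by (intro Max_in) auto
  have "l2_multiplicity M A t = Sup (enat ` P)"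
    unfolding l2_multiplicity_def l2_dim_def P_def by (rule arg_cong[where f = Sup]) auto
  also have "\<dots> = enat (Max P)"
  proof (rule antisym)
    show "Sup (enat ` P) \<le> enat (Max P)" by (rule Sup_least) (use fin in auto)
    show "enat (Max P) \<le> Sup (enat ` P)" by (rule Sup_upper) (use M in auto)
  qed
  finally show thesis using M that by (auto simp: P_def)
qed

text \<open>Justifies the choice in \<open>eigenvalue_seq\<close>. Every eigenvalue that is at least
  \<open>t\<close> contributes at least 1 to the total multiplicity, so there are at most
  \<open>hs / t\<close> of them and they can be listed in decreasing order.\<close>

lemma eigenvalue_seq_exists: "\<exists>lam. is_eigenvalue_seq M A lam"
proof -
  have "\<exists>n f. l2_multiplicity M A t = enat n \<and> (\<forall>i<n. f i \<in> l2_eigenspace M A t) \<and>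
      l2_independent M n f" if "0 < t" for t
    using l2_multiplicity_witness[OF that] by metis
  then obtain m f where m: "\<And>t. 0 < t \<Longrightarrow> l2_multiplicity M A t = enat (m t)"
    and f: "\<And>t i. 0 < t \<Longrightarrow> i < m t \<Longrightarrow> f t i \<in> l2_eigenspace M A t"
    and ind: "\<And>t. 0 < t \<Longrightarrow> l2_independent M (m t) (f t)"
    by metis
  have "finite {s. t \<le> s \<and> m s > 0}" if t: "0 < t" for t
  proof (rule conjunct1[OF finite_if_finite_subsets_card_bdd])
    fix F assume F: "F \<subseteq> {s. t \<le> s \<and> m s > 0}" "finite F"
    have "card F = (\<Sum>s\<in>F. 1)" by simp
    also have "\<dots> \<le> (\<Sum>s\<in>F. m s)" by (rule sum_mono) (use F in force)
    finally have "t * real (card F) \<le> t * real (\<Sum>s\<in>F. m s)"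
      using t by (simp del: of_nat_sum)
    also have "\<dots> \<le> hs"
      by (rule eigenvalue_count[of F t m f]) (use F t f ind in \<open>force+\<close>)
    finally have "real (card F) \<le> hs / t" using t by (simp add: field_simps)
    then show "card F \<le> nat \<lfloor>hs / t\<rfloor>" by (simp add: le_nat_floor)
  qed
  then obtain lam :: "nat \<Rightarrow> real" where "\<And>l. 0 \<le> lam l" "\<And>l. lam (Suc l) \<le> lam l"
    "\<And>t. 0 < t \<Longrightarrow> finite {l. 1 \<le> l \<and> lam l = t}"
    "\<And>t. 0 < t \<Longrightarrow> card {l. 1 \<le> l \<and> lam l = t} = m t"
    using decreasing_enumeration_exists[of m] by blast
  then show ?thesis unfolding is_eigenvalue_seq_def using m by (intro exI[of _ lam]) simp
qed

text \<open>The two orthogonal eigenfunctions account for two different positions in the list: for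
  \<open>s = t\<close> because the multiplicity is at least 2, otherwise because the values differ.
  The later position is at least 2, and the list decreases.\<close>

lemma second_eigenvalue_ge:
  assumes lam: "is_eigenvalue_seq M A lam"
    and u: "u \<in> l2_eigenspace M A s" "l2_inner M u u \<noteq> 0" "0 < s"
    and v: "v \<in> l2_eigenspace M A t" "l2_inner M v v \<noteq> 0" "0 < t"
    and orth: "l2_inner M u v = 0"
  shows "min s t \<le> lam 2"
proof -
  have u': "u \<in> l2_space M" and v': "v \<in> l2_space M" using u v by (auto simp: l2_eigenspace_def)
  have index: "n \<le> card {l. 1 \<le> l \<and> lam l = r}" "finite {l. 1 \<le> l \<and> lam l = r}"
    if r: "0 < r" "enat n \<le> l2_multiplicity M A r" for r n
  proof -
    have fin: "finite {l. 1 \<le> l \<and> lam l = r}"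
      and card: "enat (card {l. 1 \<le> l \<and> lam l = r}) = l2_multiplicity M A r"
      using lam r(1) unfolding is_eigenvalue_seq_def by blast+
    show "n \<le> card {l. 1 \<le> l \<and> lam l = r}" using r(2) by (simp flip: card)
    show "finite {l. 1 \<le> l \<and> lam l = r}" by (rule fin)
  qed
  have ex1: "\<exists>l\<ge>1. lam l = r"
    if w: "w \<in> l2_eigenspace M A r" "l2_inner M w w \<noteq> 0" "0 < r" for w r
  proof -
    have w': "w \<in> l2_space M" using w by (simp add: l2_eigenspace_def)
    have "l2_independent M 1 (\<lambda>_. w)"
      unfolding l2_independent_def
    proof (intro allI impI)
      fix c :: "nat \<Rightarrow> real" and i :: nat
      assume "AE x in M. (\<Sum>i<1. c i * w x) = 0" and i: "i < 1"
      then have "AE x in M. c 0 * w x = 0" by simp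
      then have "l2_inner M (\<lambda>x. c 0 * w x) (\<lambda>x. c 0 * w x) = 0"
        using l2_inner_self_eq_0_iff[OF l2_scale[OF w']] by blast
      then show "c i = 0" using w(2) i by (simp add: l2_inner_scale_left l2_inner_scale_right)
    qed
    then have "enat 1 \<le> l2_multiplicity M A r" using w(1) by (intro l2_multiplicity_ge)
    from index(1)[OF w(3) this] have "{l. 1 \<le> l \<and> lam l = r} \<noteq> {}" by (metis card.empty not_one_le_zero)
    then show ?thesis by blast
  qed
  have "\<exists>i j. 1 \<le> i \<and> i < j \<and> min s t \<le> lam j"
  proof (cases "s = t")
    case True
    define f where "f i = (if i = 0 then u else v)" for i :: nat
    have "l2_independent M 2 f"
      unfolding l2_independent_def
    proof (intro allI impI)
      fix c :: "nat \<Rightarrow> real" and i :: nat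
      assume "AE x in M. (\<Sum>i<2. c i * f i x) = 0" and i: "i < 2"
      then have "AE x in M. c 0 * u x + c 1 * v x = 0" by (simp add: f_def numeral_2_eq_2)
      then have z: "AE x in M. (c 0 * u x + c 1 * v x) * u x = 0"
        "AE x in M. (c 0 * u x + c 1 * v x) * v x = 0" by auto
      have "c 0 * l2_inner M u u + c 1 * l2_inner M v u = l2_inner M (\<lambda>x. c 0 * u x + c 1 * v x) u"
        using l2_inner_add_left[OF l2_scale[OF u'] l2_scale[OF v'] u'] by (simp add: l2_inner_scale_left)
      also have "\<dots> = 0" unfolding l2_inner_def by (rule integral_eq_zero_AE[OF z(1)])
      finally have c0: "c 0 = 0" using u orth by (simp add: l2_inner_commute)
      have "c 0 * l2_inner M u v + c 1 * l2_inner M v v = l2_inner M (\<lambda>x. c 0 * u x + c 1 * v x) v"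
        using l2_inner_add_left[OF l2_scale[OF u'] l2_scale[OF v'] v'] by (simp add: l2_inner_scale_left)
      also have "\<dots> = 0" unfolding l2_inner_def by (rule integral_eq_zero_AE[OF z(2)])
      finally have "c 1 = 0" using v orth by simp
      then show "c i = 0" using c0 i by (auto simp: less_2_cases_iff)
    qed
    then have "enat 2 \<le> l2_multiplicity M A s"
      using u v True by (intro l2_multiplicity_ge) (auto simp: f_def)
    from index(1)[OF u(3) this] have "2 \<le> card {l. 1 \<le> l \<and> lam l = s}" .
    then have "\<not> card {l. 1 \<le> l \<and> lam l = s} \<le> Suc 0" by simp
    then obtain i j where "1 \<le> i" "lam i = s" "1 \<le> j" "lam j = s" "i \<noteq> j"
      using index(2)[OF u(3) \<open>enat 2 \<le> l2_multiplicity M A s\<close>]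
      by (subst (asm) card_le_Suc0_iff_eq) auto
    then show ?thesis using True by (metis linorder_neqE_nat min.idem order_refl)
  next
    case False
    obtain i j where "1 \<le> i" "lam i = s" "1 \<le> j" "lam j = t" using ex1 u v by metis
    moreover from this False have "i \<noteq> j" by auto
    ultimately show ?thesis by (metis linorder_neqE_nat min.cobounded1 min.cobounded2)
  qed
  then obtain i j where ij: "1 \<le> i" "i < j" "min s t \<le> lam j" by blast
  have "lam j \<le> lam 2"
  proof (rule dec_induct[of 2 j "\<lambda>j. lam j \<le> lam 2"])
    show "2 \<le> j" using ij by simp
    fix n :: nat assume "2 \<le> n" "lam n \<le> lam 2"
    moreover from this have "lam (Suc n) \<le> lam n" using lam by (simp add: is_eigenvalue_seq_def)
    ultimately show "lam (Suc n) \<le> lam 2" by simp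
  qed simp
  then show ?thesis using ij by simp
qed

end

subsection \<open>Power iteration\<close>

lemma ratio_tendsto_shift:
  fixes b :: "nat \<Rightarrow> real"
  assumes pos: "\<And>n. 0 < b n" and ratio: "(\<lambda>n. b (Suc n) / b n) \<longlonglongrightarrow> 1"
  shows "(\<lambda>n. b n / b (n + p)) \<longlonglongrightarrow> 1"
proof (induction p)
  case 0
  have "(\<lambda>n. b n / b (n + 0)) = (\<lambda>n. 1)" using pos by (simp add: less_imp_neq[OF pos, symmetric])
  then show ?case by simp
next
  case (Suc p)
  have "(\<lambda>n. b (Suc (n + p)) / b (n + p)) \<longlonglongrightarrow> 1"
    using LIMSEQ_ignore_initial_segment[OF ratio, of p] by simp
  then have "(\<lambda>n. b n / b (n + p) / (b (Suc (n + p)) / b (n + p))) \<longlonglongrightarrow> 1 / 1"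
    by (intro tendsto_divide Suc) simp_all
  moreover have "b n / b (n + p) / (b (Suc (n + p)) / b (n + p)) = b n / b (n + Suc p)" for n
    using pos[of "n + p"] by simp
  ultimately show ?case by (simp only: div_by_1)
qed

text \<open>Fix \<open>m \<ge> i\<close>. Since the ratios tend to 1, b(i+j) is at most 2 b(m+j) for
  large \<open>j\<close>, and \<open>CS\<close> bounds b(m+j) by the square root of b(2m) b(2j). The
  quotient is thus eventually at most twice the root of b(2m), which is small for large
  \<open>m\<close>.\<close>

lemma subgeometric_correlation_decay:
  fixes b :: "nat \<Rightarrow> real"
  assumes pos: "\<And>n. 0 < b n" and ratio: "(\<lambda>n. b (Suc n) / b n) \<longlonglongrightarrow> 1"
    and lim: "b \<longlonglongrightarrow> 0" and CS: "\<And>m j. (b (m + j))\<^sup>2 \<le> b (2 * m) * b (2 * j)"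
  shows "(\<lambda>j. b (i + j) / sqrt (b (2 * j))) \<longlonglongrightarrow> 0"
proof (rule LIMSEQ_I)
  fix e :: real assume e: "0 < e"
  have "\<forall>\<^sub>F n in sequentially. b n < (e / 2)\<^sup>2" using lim e by (auto intro: order_tendstoD)
  then obtain m0 where m0: "\<And>n. n \<ge> m0 \<Longrightarrow> b n < (e / 2)\<^sup>2" by (auto simp: eventually_sequentially)
  define m where "m = max i m0"
  have "b (2 * m) < (e / 2)\<^sup>2" using m0 by (simp add: m_def)
  then have bm: "sqrt (b (2 * m)) < e / 2" using e by (metis abs_of_pos half_gt_zero real_sqrt_abs real_sqrt_less_mono)
  have "(\<lambda>j. b j / b (j + (m - i))) \<longlonglongrightarrow> 1" by (rule ratio_tendsto_shift[OF pos ratio])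
  then have "\<forall>\<^sub>F j in sequentially. b j / b (j + (m - i)) < 2" by (rule order_tendstoD) simp
  then obtain J where J: "\<And>j. j \<ge> J \<Longrightarrow> b j / b (j + (m - i)) < 2" by (auto simp: eventually_sequentially)
  have "norm (b (i + j) / sqrt (b (2 * j)) - 0) < e" if j: "j \<ge> J" for j
  proof -
    have "m = i + (m - i)" by (simp add: m_def)
    then have "b (i + j) / b (m + j) < 2" using J[of "i + j"] j by (simp add: add.commute add.left_commute)
    then have 1: "b (i + j) \<le> 2 * b (m + j)" using pos[of "m + j"] by (simp add: divide_simps)
    have "b (m + j) \<le> sqrt (b (2 * m)) * sqrt (b (2 * j))"
      using real_le_rsqrt[OF CS[of m j]] by (simp add: real_sqrt_mult)
    with 1 have "b (i + j) \<le> 2 * sqrt (b (2 * m)) * sqrt (b (2 * j))" by simp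
    then have "b (i + j) / sqrt (b (2 * j)) \<le> 2 * sqrt (b (2 * m))"
      using pos[of "2 * j"] by (simp add: divide_simps)
    also have "\<dots> < e" using bm by simp
    finally show ?thesis using pos[of "i + j"] pos[of "2 * j"] by simp
  qed
  then show "\<exists>no. \<forall>n\<ge>no. norm (b (i + n) / sqrt (b (2 * n)) - 0) < e" by blast
qed

text \<open>Indices are chosen one after another. The finitely many rows belonging to earlier
  choices all tend to 0, so a far enough next index has small correlation with each of them.\<close>

lemma almost_orthogonal_selection:
  fixes p :: "nat \<Rightarrow> nat \<Rightarrow> real"
  assumes lim: "\<And>i. p i \<longlonglongrightarrow> 0" and sym: "\<And>i j. p i j = p j i" and "0 < \<delta>"
  shows "\<exists>s :: nat \<Rightarrow> nat. \<forall>i<n. \<forall>j<n. i \<noteq> j \<longrightarrow> \<bar>p (s i) (s j)\<bar> \<le> \<delta>"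
proof (induction n)
  case (Suc n)
  then obtain s :: "nat \<Rightarrow> nat" where s: "\<And>i j. i < n \<Longrightarrow> j < n \<Longrightarrow> i \<noteq> j \<Longrightarrow> \<bar>p (s i) (s j)\<bar> \<le> \<delta>"
    by blast
  have "\<forall>\<^sub>F j in sequentially. \<bar>p (s i) j\<bar> < \<delta>" for i
    using tendsto_rabs[OF lim[of "s i"]] \<open>0 < \<delta>\<close> by (auto intro: order_tendstoD)
  then have "\<forall>\<^sub>F j in sequentially. \<forall>i\<in>{..<n}. \<bar>p (s i) j\<bar> < \<delta>"
    by (intro eventually_ball_finite) auto
  then obtain q where q: "\<And>i. i < n \<Longrightarrow> \<bar>p (s i) q\<bar> < \<delta>"
    by (metis (lifting) eventually_sequentially le_refl lessThan_iff)
  have "\<bar>p ((s(n := q)) i) ((s(n := q)) j)\<bar> \<le> \<delta>" if "i < Suc n" "j < Suc n" "i \<noteq> j" for i j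
    using that s[of i j] q[of i] q[of j] sym[of q "s j"] by (auto simp: less_Suc_eq)
  then show ?case by blast
qed simp

section \<open>Limits of images of Cauchy sequences\<close>

context l2_kernel
begin

lemma kernel_op_norm_le:
  assumes f: "f \<in> l2_space M"
  shows "l2_inner N (kernel_op M k f) (kernel_op M k f) \<le> hs * l2_inner M f f"
proof -
  have "l2_inner N (kernel_op M k f) (kernel_op M k f) = (\<integral>y. (kernel_op M k f y)\<^sup>2 \<partial>N)"
    by (simp add: l2_inner_def power2_eq_square)
  also have "\<dots> \<le> (\<integral>y. l2_inner M (\<lambda>x. k x y) (\<lambda>x. k x y) * l2_inner M f f \<partial>N)"
    using kernel_op_bound[OF f] l2_spaceD(2)[OF kernel_op_l2[OF f]]
    by (intro integral_mono_AE integrable_mult_left integrable_section_norm)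
  also have "\<dots> = hs * l2_inner M f f" by (simp add: hs_eq)
  finally show ?thesis .
qed

text \<open>
  The values \<open>kernel_op M k (g n) y\<close> converge for almost every \<open>y\<close> and are dominated by a
  square-integrable function, so completeness of \<open>L\<^sup>2(M)\<close> is not needed.
\<close>

lemma kernel_op_Cauchy_limit:
  assumes g: "\<And>n. g n \<in> l2_space M" and bound: "\<And>n. l2_inner M (g n) (g n) \<le> B"
    and cauchy: "\<And>e. 0 < e \<Longrightarrow> \<exists>n0. \<forall>m\<ge>n0. \<forall>n\<ge>n0.
      l2_inner M (\<lambda>x. g m x - g n x) (\<lambda>x. g m x - g n x) < e"
  obtains w where "w \<in> l2_space N"
    "\<And>v. v \<in> l2_space N \<Longrightarrow> (\<lambda>n. l2_inner N (kernel_op M k (g n)) v) \<longlonglongrightarrow> l2_inner N w v"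
proof -
  define K where "K y = l2_inner M (\<lambda>x. k x y) (\<lambda>x. k x y)" for y
  \<comment> \<open>Where the sequence diverges \<open>lim\<close> is unspecified;
    \<open>conv\<close> shows that this happens only on a null set.\<close>
  define w where "w y = lim (\<lambda>n. kernel_op M k (g n) y)" for y
  have K0: "0 \<le> K y" for y by (simp add: K_def)
  have gm: "kernel_op M k (g n) \<in> borel_measurable N" for n
    using kernel_op_l2[OF g] by (rule l2_spaceD)
  have wm: "w \<in> borel_measurable N" unfolding w_def using gm by measurable
  have conv: "AE y in N. (\<lambda>n. kernel_op M k (g n) y) \<longlonglongrightarrow> w y"
    using section_l2
  proof eventually_elim
    case (elim y)
    have "Cauchy (\<lambda>n. kernel_op M k (g n) y)"
    proof (rule CauchyI)
      fix e :: real assume e: "0 < e"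
      \<comment> \<open>The summand 1 keeps the denominator positive when the section of the kernel
        has norm 0.\<close>
      define d where "d = e\<^sup>2 / (K y + 1)"
      have "0 < d" using e K0[of y] by (simp add: d_def add_nonneg_pos)
      from cauchy[OF this] obtain n0 where n0: "\<forall>m\<ge>n0. \<forall>n\<ge>n0.
          l2_inner M (\<lambda>x. g m x - g n x) (\<lambda>x. g m x - g n x) < d"
        by (elim exE)
      have "norm (kernel_op M k (g m) y - kernel_op M k (g n) y) < e" if "m \<ge> n0" "n \<ge> n0" for m n
      proof -
        have "(kernel_op M k (g m) y - kernel_op M k (g n) y)\<^sup>2
            = (l2_inner M (\<lambda>x. k x y) (\<lambda>x. g m x - g n x))\<^sup>2"
          using elim g by (simp add: kernel_op_eq_inner l2_inner_diff_right)
        also have "\<dots> \<le> K y * l2_inner M (\<lambda>x. g m x - g n x) (\<lambda>x. g m x - g n x)"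
          unfolding K_def using elim g by (intro l2_Cauchy_Schwarz l2_diff)
        also have "\<dots> \<le> K y * d"
          using n0 that by (intro mult_left_mono K0 less_imp_le) simp
        also have "\<dots> < (K y + 1) * d" using \<open>0 < d\<close> by simp
        also have "\<dots> = e\<^sup>2" using K0[of y] by (simp add: d_def add_nonneg_eq_0_iff)
        finally have "\<bar>kernel_op M k (g m) y - kernel_op M k (g n) y\<bar>\<^sup>2 < e\<^sup>2" by simp
        then show ?thesis
          unfolding real_norm_def by (rule power2_less_imp_less) (use e in simp)
      qed
      then show "\<exists>n0. \<forall>m\<ge>n0. \<forall>n\<ge>n0. norm (kernel_op M k (g m) y - kernel_op M k (g n) y) < e"
        by (intro exI[of _ n0] allI impI)
    qed
    then have "convergent (\<lambda>n. kernel_op M k (g n) y)" by (rule Cauchy_convergent)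
    then show ?case by (simp add: w_def convergent_LIMSEQ_iff)
  qed
  have bd: "AE y in N. \<forall>n. (kernel_op M k (g n) y)\<^sup>2 \<le> K y * B"
    unfolding AE_all_countable
  proof
    fix n
    show "AE y in N. (kernel_op M k (g n) y)\<^sup>2 \<le> K y * B"
      using kernel_op_bound[OF g[of n]]
    proof eventually_elim
      case (elim y)
      then have "(kernel_op M k (g n) y)\<^sup>2 \<le> K y * l2_inner M (g n) (g n)" by (simp add: K_def)
      also have "\<dots> \<le> K y * B" by (intro mult_left_mono bound K0)
      finally show ?case .
    qed
  qed
  have bdw: "AE y in N. (w y)\<^sup>2 \<le> K y * B"
    using conv bd
  proof eventually_elim
    case (elim y)
    have "(\<lambda>n. (kernel_op M k (g n) y)\<^sup>2) \<longlonglongrightarrow> (w y)\<^sup>2" by (intro tendsto_power elim(1))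
    then show ?case by (rule LIMSEQ_le_const2) (use elim(2) in blast)
  qed
  have KB: "integrable N (\<lambda>y. K y * B)"
    unfolding K_def by (intro integrable_mult_left integrable_section_norm)
  have "integrable N (\<lambda>y. (w y)\<^sup>2)"
    by (rule Bochner_Integration.integrable_bound[OF KB]) (use wm bdw in auto)
  then have w: "w \<in> l2_space N" using wm by (simp add: l2_space_def)
  have "(\<lambda>n. l2_inner N (kernel_op M k (g n)) v) \<longlonglongrightarrow> l2_inner N w v" if v: "v \<in> l2_space N" for v
    unfolding l2_inner_def
  proof (rule integral_dominated_convergence)
    have vm: "v \<in> borel_measurable N" using v by (rule l2_spaceD)
    show "(\<lambda>y. w y * v y) \<in> borel_measurable N" using wm vm by simp
    show "(\<lambda>y. kernel_op M k (g n) y * v y) \<in> borel_measurable N" for n using gm vm by simp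
    show "integrable N (\<lambda>y. K y * B + (v y)\<^sup>2)" using KB l2_spaceD(2)[OF v] by simp
    show "AE y in N. (\<lambda>n. kernel_op M k (g n) y * v y) \<longlonglongrightarrow> w y * v y"
      using conv by eventually_elim (intro tendsto_mult tendsto_const)
    show "AE y in N. norm (kernel_op M k (g n) y * v y) \<le> K y * B + (v y)\<^sup>2" for n
      using bd
    proof eventually_elim
      case (elim y)
      have "\<bar>kernel_op M k (g n) y * v y\<bar> \<le> ((kernel_op M k (g n) y)\<^sup>2 + (v y)\<^sup>2) / 2"
        by (rule abs_mult_le_mean_squares)
      also have "\<dots> \<le> (K y * B + (v y)\<^sup>2 + (K y * B + (v y)\<^sup>2)) / 2"
        using elim zero_le_power2[of "v y"] order_trans[OF zero_le_power2 elim[rule_format]]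
        by (intro divide_right_mono add_mono order_trans[OF elim[rule_format]]) auto
      also have "\<dots> = K y * B + (v y)\<^sup>2" by simp
      finally show ?case unfolding real_norm_def .
    qed
  qed
  with w show thesis by (rule that)
qed

end

section \<open>An eigenfunction as limit of the iterates\<close>

context l2_kernel_adjoint
begin

text \<open>In spectral terms, the numbers <A^n f, f> are the moments of the spectral measure of
  \<open>f\<close>, \<open>r\<close> is the top of its support, and the limit of A^n f / r^n is the
  component of \<open>f\<close> in the eigenspace of \<open>r\<close>. The last conclusion follows
  from <A^n f, h> = t^n <f, h>: orthogonality to \<open>h\<close> survives iteration and the weak
  limit.\<close>

lemma top_of_cyclic_spectrum_is_eigenvalue:
  assumes f: "f \<in> l2_space M"
    and Lf: "0 < l2_inner N (kernel_op M k f) (kernel_op M k f)"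
  obtains r g where "0 < r"
    "l2_inner N (kernel_op M k f) (kernel_op M k f) \<le> r * l2_inner M f f"
    "g \<in> l2_eigenspace M A r" "l2_inner M g g \<noteq> 0"
    "\<And>t h. h \<in> l2_eigenspace M A t \<Longrightarrow> l2_inner M f h = 0 \<Longrightarrow> l2_inner M g h = 0"
proof -
  define F where "F n = (A ^^ n) f" for n
  define a where "a n = l2_inner M (F n) f" for n
  have F: "F n \<in> l2_space M" for n
    by (induction n) (use f A_l2 in \<open>simp_all add: F_def\<close>)
  have F_Suc: "F (Suc n) = A (F n)" for n by (simp add: F_def)
  have inner: "l2_inner M (F n) (F m) = a (n + m)" for n m
  proof (induction m arbitrary: n)
    case 0
    then show ?case by (simp add: a_def F_def)
  next
    case (Suc m)
    have "l2_inner M (F n) (F (Suc m)) = l2_inner M (F (Suc n)) (F m)"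
      using A_sym[OF F F] by (simp add: F_Suc del: comp_apply)
    then show ?case using Suc by simp
  qed
  have inner_L: "l2_inner N (kernel_op M k (F n)) (kernel_op M k (F m)) = a (Suc (n + m))" for n m
    using A_inner[OF F F, of n m] inner[of "Suc n" m] by (simp add: F_Suc del: comp_apply)
  have parity: "\<exists>m. n = 2 * m \<or> n = Suc (2 * m)" for n :: nat by presburger
  have nonneg: "0 \<le> a n" for n
  proof -
    obtain m where "n = m + m \<or> n = Suc (m + m)" using parity[of n] by (auto simp: mult_2)
    then show ?thesis using inner[of m m] inner_L[of m m] by (metis l2_inner_self_nonneg)
  qed
  \<comment> \<open>Cauchy-Schwarz for two consecutive iterates when \<open>n\<close> is even, and
    for their images under the kernel operator when \<open>n\<close> is odd.\<close>
  have convex: "(a (Suc n))\<^sup>2 \<le> a n * a (Suc (Suc n))" for n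
  proof -
    obtain m where "n = m + m \<or> n = Suc (m + m)" using parity[of n] by (auto simp: mult_2)
    then show ?thesis
    proof
      assume "n = m + m"
      then show ?thesis
        using l2_Cauchy_Schwarz[OF F[of m] F[of "Suc m"]] by (simp add: inner)
    next
      assume "n = Suc (m + m)"
      then show ?thesis
        using l2_Cauchy_Schwarz[OF kernel_op_l2[OF F[of m]] kernel_op_l2[OF F[of "Suc m"]]]
        by (simp add: inner_L)
    qed
  qed
  have bound: "a (Suc (2 * n)) \<le> hs * a (2 * n)" for n
    using kernel_op_norm_le[OF F[of n]] by (simp add: inner inner_L mult_2)
  have a0: "a 0 = l2_inner M f f" by (simp add: a_def F_def)
  have a1: "a 1 = l2_inner N (kernel_op M k f) (kernel_op M k f)"
    using inner_L[of 0 0] by (simp add: F_def)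
  have "0 < a 1" using Lf a1 by simp
  moreover have "0 < a 0"
    using \<open>0 < a 1\<close> bound[of 0] nonneg[of 0] by (cases "a 0 = 0") auto
  ultimately obtain r where r: "0 < r" "a 1 / a 0 \<le> r" and apos: "\<And>n. 0 < a n"
    and q0: "\<And>n. a 1 / a 0 \<le> a (Suc n) / a n"
    and qr: "\<And>n. a (Suc n) / a n \<le> r" and q_lim: "(\<lambda>n. a (Suc n) / a n) \<longlonglongrightarrow> r"
    using log_convex_growth_rate[of a hs] nonneg convex bound by blast
  \<comment> \<open>Division by \<open>r ^ n\<close> brings the ratios to at most 1 with limit 1, so
    \<open>b\<close> decreases. The functions \<open>g n\<close> defined below have inner products
    <g n, g m> = b(n+m).\<close>
  define b where "b n = a n / r ^ n" for n
  define c where "c n = 1 / r ^ n" for n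
  define g where "g n = (\<lambda>x. c n * F n x)" for n
  have bpos: "0 < b n" for n using apos r by (simp add: b_def)
  have b_ratio: "b (Suc n) / b n = (a (Suc n) / a n) / r" for n
    using r by (simp add: b_def field_simps)
  have "decseq b"
  proof (rule decseq_SucI)
    fix n
    have "b (Suc n) / b n \<le> 1" unfolding b_ratio using qr[of n] r(1) by (subst divide_le_eq_1_pos)
    then show "b (Suc n) \<le> b n" using bpos[of n] by (simp add: divide_simps)
  qed
  then obtain \<beta> where \<beta>: "b \<longlonglongrightarrow> \<beta>" "\<And>n. \<beta> \<le> b n"
    using decseq_convergent[OF \<open>decseq b\<close>, of 0] bpos less_imp_le by blast
  have ratio_lim: "(\<lambda>n. b (Suc n) / b n) \<longlonglongrightarrow> 1"
    unfolding b_ratio using tendsto_divide[OF q_lim tendsto_const[of r]] r by simp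
  have g: "g n \<in> l2_space M" for n unfolding g_def by (intro l2_scale F)
  have inner_g: "l2_inner M (g n) (g m) = b (n + m)" for n m
  proof -
    have "l2_inner M (g n) (g m) = c n * (c m * a (n + m))"
      by (simp add: g_def l2_inner_scale_left l2_inner_scale_right inner)
    then show ?thesis by (simp add: b_def c_def power_add)
  qed
  have CS: "(b (m + j))\<^sup>2 \<le> b (2 * m) * b (2 * j)" for m j
    using l2_Cauchy_Schwarz[OF g[of m] g[of j]] by (simp add: inner_g mult_2)
  have "\<beta> \<noteq> 0"
  proof
    assume "\<beta> = 0"
    \<comment> \<open>The squared norm of \<open>g n\<close> is b(2n), so the functions
      \<open>h n\<close> are unit vectors and \<open>p\<close> is their matrix of
      correlations.\<close>
    define d where "d n = 1 / sqrt (b (2 * n))" for n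
    define h where "h n = (\<lambda>x. d n * g n x)" for n
    define p where "p i j = l2_inner M (h i) (h j)" for i j
    have h: "h n \<in> l2_space M" for n unfolding h_def by (intro l2_scale g)
    have p_eq: "p i j = d i * (b (i + j) / sqrt (b (2 * j)))" for i j
    proof -
      have "p i j = d i * (d j * b (i + j))"
        by (simp add: p_def h_def l2_inner_scale_left l2_inner_scale_right inner_g)
      then show ?thesis by (simp add: d_def)
    qed
    have p_diag: "p i i = 1" for i
      using bpos[of "2 * i"] by (simp add: p_eq d_def flip: mult_2)
    have p_lim: "p i \<longlonglongrightarrow> 0" for i
      unfolding p_eq using \<beta>(1) \<open>\<beta> = 0\<close> bpos ratio_lim CS
      by (intro tendsto_mult_right_zero subgeometric_correlation_decay) auto
    have p_sym: "p i j = p j i" for i j by (simp add: p_def l2_inner_commute)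
    define C where "C = a 1 / a 0"
    have "0 < C" using apos by (simp add: C_def)
    \<comment> \<open>For the unit vector \<open>h i\<close> the right-hand side is the ratio
      a(2i+1) / a(2i), and the ratios never fall below the first one.\<close>
    have Lh: "C \<le> l2_inner N (kernel_op M k (h i)) (kernel_op M k (h i))" for i
    proof -
      define z where "z = d i * c i"
      have "h i = (\<lambda>x. z * F i x)" by (simp add: h_def g_def z_def mult.assoc)
      moreover have "kernel_op M k (\<lambda>x. c * F i x) = (\<lambda>y. c * kernel_op M k (F i) y)" for c
        by (rule ext) (simp add: kernel_op_eq_inner l2_inner_scale_right)
      ultimately have "l2_inner N (kernel_op M k (h i)) (kernel_op M k (h i))
          = z\<^sup>2 * a (Suc (2 * i))"
        by (simp add: l2_inner_scale_left l2_inner_scale_right inner_L power2_eq_square mult_2)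
      also have "\<dots> = a (Suc (2 * i)) / a (2 * i)"
        using bpos[of "2 * i"] r apos[of "2 * i"]
        by (simp add: power_mult_distrib power_divide b_def c_def d_def z_def power_mult[symmetric] mult.commute)
      finally show ?thesis using q0[of "2 * i"] by (simp add: C_def)
    qed
    have main: "real n * C \<le> 2 * hs" if n: "0 < n" for n :: nat
    proof -
      \<comment> \<open>With tolerance 1/n the factor 1 + n delta equals 2, so the upper bound stays
        fixed while n C grows.\<close>
      obtain s :: "nat \<Rightarrow> nat"
        where s: "\<And>i j. i < n \<Longrightarrow> j < n \<Longrightarrow> i \<noteq> j \<Longrightarrow> \<bar>p (s i) (s j)\<bar> \<le> 1 / real n"
        using almost_orthogonal_selection[OF p_lim p_sym, of "1 / real n" n] n by auto
      have "real n * C = (\<Sum>i<n. C)" by simp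
      also have "\<dots> \<le> (\<Sum>i<n. l2_inner N (kernel_op M k (h (s i))) (kernel_op M k (h (s i))))"
        by (intro sum_mono Lh)
      also have "\<dots> \<le> (1 + real n * (1 / real n)) * hs"
        by (rule Hilbert_Schmidt_bound) (use h p_diag s in \<open>auto simp: p_def\<close>)
      also have "\<dots> = 2 * hs" using n by simp
      finally show ?thesis .
    qed
    obtain n :: nat where "2 * hs / C < real n" using reals_Archimedean2 by blast
    then have lt: "2 * hs < real (Suc n) * C" using \<open>0 < C\<close> by (simp add: divide_simps algebra_simps)
    show False using main[of "Suc n"] lt by simp
  qed
  then have "0 < \<beta>"
    using LIMSEQ_le_const[OF \<beta>(1), of 0] bpos by (metis less_imp_le order_le_less)
  have "l2_inner M (g n) (g n) \<le> b 0" for n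
    unfolding inner_g by (rule decseqD[OF \<open>decseq b\<close>]) simp
  moreover have "\<exists>n0. \<forall>m\<ge>n0. \<forall>n\<ge>n0. l2_inner M (\<lambda>x. g m x - g n x) (\<lambda>x. g m x - g n x) < e"
    if e: "0 < e" for e
  proof -
    \<comment> \<open>The squared distance of \<open>g m\<close> and \<open>g n\<close> is b(2m) - 2
      b(m+n) + b(2n). Beyond \<open>n0\<close> the outer terms are below \<beta> + e/2, and b(m+n)
      is at least \<beta>.\<close>
    have "\<forall>\<^sub>F n in sequentially. b n < \<beta> + e / 2" using \<beta>(1) e by (intro order_tendstoD) auto
    then obtain n0 where n0: "\<And>n. n \<ge> n0 \<Longrightarrow> b n < \<beta> + e / 2" by (auto simp: eventually_sequentially)
    have "l2_inner M (\<lambda>x. g m x - g n x) (\<lambda>x. g m x - g n x) < e" if "m \<ge> n0" "n \<ge> n0" for m n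
    proof -
      have "l2_inner M (\<lambda>x. g m x - g n x) (\<lambda>x. g m x - g n x)
          = b (m + m) - b (m + n) - (b (n + m) - b (n + n))"
        using g by (simp add: l2_inner_diff_left l2_inner_diff_right l2_diff inner_g)
      then show ?thesis
        using n0[of "m + m"] n0[of "n + n"] \<beta>(2)[of "m + n"] \<beta>(2)[of "n + m"] that by simp
    qed
    then show ?thesis by blast
  qed
  ultimately obtain w where w: "w \<in> l2_space N" and w_lim: "\<And>v. v \<in> l2_space N \<Longrightarrow>
      (\<lambda>n. l2_inner N (kernel_op M k (g n)) v) \<longlonglongrightarrow> l2_inner N w v"
    using kernel_op_Cauchy_limit[of g "b 0"] g by blast
  \<comment> \<open>Only the images of the \<open>g n\<close> are known to have a limit, namely
    \<open>w\<close>. As \<open>A (g n)\<close> is weakly r g(n+1), applying the adjoint to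
    \<open>w\<close> and dividing by \<open>r\<close> gives the weak limit of \<open>g\<close>
    itself.\<close>
  define s where "s = 1 / r"
  define G where "G = (\<lambda>x. s * T w x)"
  have Tw: "T w \<in> l2_space M" using adjoint w by (simp add: is_l2_adjoint_def)
  have G: "G \<in> l2_space M" unfolding G_def by (intro l2_scale Tw)
  have A_g: "l2_inner M (A (g n)) v = r * l2_inner M (g (Suc n)) v" if v: "v \<in> l2_space M" for n v
  proof -
    have "l2_inner M (A (g n)) v = c n * l2_inner M (F n) (A v)"
      using A_sym[OF g v] by (simp add: g_def l2_inner_scale_left del: comp_apply)
    also have "\<dots> = c n * l2_inner M (F (Suc n)) v"
      using A_sym[OF F v] by (simp add: F_Suc del: comp_apply)
    also have "\<dots> = r * (c (Suc n) * l2_inner M (F (Suc n)) v)" using r by (simp add: c_def)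
    also have "\<dots> = r * l2_inner M (g (Suc n)) v" by (simp add: g_def l2_inner_scale_left)
    finally show ?thesis .
  qed
  have weak_Suc: "(\<lambda>n. l2_inner M (g (Suc n)) v) \<longlonglongrightarrow> l2_inner M G v" if v: "v \<in> l2_space M" for v
  proof -
    have "(\<lambda>n. s * l2_inner N (kernel_op M k (g n)) (kernel_op M k v))
        \<longlonglongrightarrow> s * l2_inner N w (kernel_op M k v)"
      by (intro tendsto_mult_left w_lim kernel_op_l2 v)
    moreover have "s * l2_inner N w (kernel_op M k v) = l2_inner M G v"
    proof -
      have "l2_inner N (kernel_op M k v) w = l2_inner M v (T w)"
        using adjoint w v by (simp add: is_l2_adjoint_def)
      then show ?thesis by (simp add: G_def l2_inner_scale_left l2_inner_commute)
    qed
    moreover have "s * l2_inner N (kernel_op M k (g n)) (kernel_op M k v)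
        = l2_inner M (g (Suc n)) v" for n
      using A_g[OF v] A_inner[OF g v] r by (simp add: s_def del: comp_apply)
    ultimately show ?thesis by simp
  qed
  have weak: "(\<lambda>n. l2_inner M (g n) v) \<longlonglongrightarrow> l2_inner M G v" if "v \<in> l2_space M" for v
    by (rule LIMSEQ_imp_Suc[OF weak_Suc[OF that]])
  have "G \<in> l2_eigenspace M A r"
    unfolding eigenspace_iff
  proof (intro conjI ballI G)
    fix v assume v: "v \<in> l2_space M"
    have "(\<lambda>n. l2_inner M (g n) (A v)) \<longlonglongrightarrow> l2_inner M G (A v)" by (rule weak[OF A_l2[OF v]])
    moreover have "(\<lambda>n. l2_inner M (g n) (A v)) \<longlonglongrightarrow> r * l2_inner M G v"
      using tendsto_mult_left[OF weak_Suc[OF v], of r] A_sym[OF g v] A_g[OF v] by simp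
    ultimately show "l2_inner M G (A v) = r * l2_inner M G v" by (rule LIMSEQ_unique)
  qed
  moreover have "l2_inner M G G \<noteq> 0"
  proof
    assume "l2_inner M G G = 0"
    then have "(l2_inner M G (g 0))\<^sup>2 \<le> 0" using l2_Cauchy_Schwarz[OF G g] by (metis mult_zero_left)
    then have "l2_inner M G (g 0) = 0" by simp
    \<comment> \<open>These inner products are the numbers \<open>b n\<close>, whose limit \<beta>
      is positive; a vanishing \<open>G\<close> would force limit 0.\<close>
    moreover have "(\<lambda>n. l2_inner M (g n) (g 0)) \<longlonglongrightarrow> \<beta>" using \<beta>(1) by (simp add: inner_g)
    ultimately show False using weak[OF g[of 0]] \<open>0 < \<beta>\<close> LIMSEQ_unique by force
  qed
  moreover have "l2_inner M G h = 0" if h: "h \<in> l2_eigenspace M A t" and fh: "l2_inner M f h = 0" for t h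
  proof -
    have h': "h \<in> l2_space M" using h by (simp add: l2_eigenspace_def)
    have "l2_inner M (F n) h = 0" for n
    proof (induction n)
      case 0
      then show ?case using fh by (simp add: F_def)
    next
      case (Suc n)
      have "l2_inner M (F (Suc n)) h = l2_inner M h (A (F n))"
        by (simp add: F_Suc l2_inner_commute del: comp_apply)
      also have "\<dots> = t * l2_inner M h (F n)" using h F by (simp add: eigenspace_iff)
      finally show ?case using Suc by (simp add: l2_inner_commute)
    qed
    then have "l2_inner M (g n) h = 0" for n by (simp add: g_def l2_inner_scale_left)
    then show ?thesis using weak[OF h'] by (simp add: LIMSEQ_const_iff)
  qed
  moreover have "l2_inner N (kernel_op M k f) (kernel_op M k f) \<le> r * l2_inner M f f"
    using r(2) apos[of 0] a0 a1 by (simp add: divide_simps)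
  ultimately show thesis using that r(1) by blast
qed

end

subsection \<open>The second singular value\<close>

context l2_kernel
begin

text \<open>Integrating over \<open>y\<close> first removes the kernel by \<open>col\<close>.
  Applied also to the transposed kernel, it covers both halves of the contraction estimate.\<close>

lemma integral_kernel_square:
  assumes nonneg: "AE x in M. AE y in N. 0 \<le> k x y"
    and col: "AE x in M. (\<integral>y. k x y \<partial>N) = 1" and f: "f \<in> l2_space M"
  shows "integrable (M \<Otimes>\<^sub>M N) (\<lambda>(x, y). k x y * (f x)\<^sup>2)"
    and "(\<integral>(x, y). k x y * (f x)\<^sup>2 \<partial>(M \<Otimes>\<^sub>M N)) = l2_inner M f f"
proof -
  have [measurable]: "f \<in> borel_measurable M" using f by (rule l2_spaceD)
  \<comment> \<open>A non-integrable function has Bochner integral 0, so the value 1 forces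
    integrability.\<close>
  have col': "AE x in M. integrable N (k x)"
    using col by eventually_elim (metis not_integrable_integral_eq zero_neq_one)
  have norm: "AE x in M. (\<integral>y. norm (case (x, y) of (x, y) \<Rightarrow> k x y * (f x)\<^sup>2) \<partial>N) = (f x)\<^sup>2"
    using nonneg col AE_space
  proof eventually_elim
    case (elim x)
    have "(\<integral>y. norm (case (x, y) of (x, y) \<Rightarrow> k x y * (f x)\<^sup>2) \<partial>N) = (\<integral>y. k x y * (f x)\<^sup>2 \<partial>N)"
    proof (rule integral_cong_AE)
      show "AE y in N. norm (case (x, y) of (x, y) \<Rightarrow> k x y * (f x)\<^sup>2) = k x y * (f x)\<^sup>2"
        using elim(1) by eventually_elim (simp add: abs_mult)
    qed (use elim(3) in measurable)
    then show ?case using elim(2) by simp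
  qed
  show int: "integrable (M \<Otimes>\<^sub>M N) (\<lambda>(x, y). k x y * (f x)\<^sup>2)"
  proof (rule Fubini_integrable)
    show "(\<lambda>(x, y). k x y * (f x)\<^sup>2) \<in> borel_measurable (M \<Otimes>\<^sub>M N)" by measurable
    have "integrable M (\<lambda>x. (f x)\<^sup>2)" using f by (rule l2_spaceD)
    then show "integrable M (\<lambda>x. \<integral>y. norm (case (x, y) of (x, y) \<Rightarrow> k x y * (f x)\<^sup>2) \<partial>N)"
      by (rule integrable_cong_AE_imp) (use norm in \<open>measurable, auto\<close>)
    show "AE x in M. integrable N (\<lambda>y. case (x, y) of (x, y) \<Rightarrow> k x y * (f x)\<^sup>2)"
      using col' by eventually_elim simp
  qed
  have "(\<integral>(x, y). k x y * (f x)\<^sup>2 \<partial>(M \<Otimes>\<^sub>M N)) = (\<integral>x. \<integral>y. k x y * (f x)\<^sup>2 \<partial>N \<partial>M)"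
    using integral_fst'[OF int] by simp
  also have "\<dots> = (\<integral>x. f x * f x \<partial>M)"
  proof (rule integral_cong_AE)
    show "AE x in M. (\<integral>y. k x y * (f x)\<^sup>2 \<partial>N) = f x * f x"
      using col by eventually_elim (simp add: power2_eq_square)
  qed measurable
  finally show "(\<integral>(x, y). k x y * (f x)\<^sup>2 \<partial>(M \<Otimes>\<^sub>M N)) = l2_inner M f f"
    by (simp add: l2_inner_def)
qed

text \<open>A Schur test. For g = L f, the squared norm of \<open>g\<close> is the double integral
  of k f g. Nonnegativity of \<open>k\<close> allows f g to be replaced by (f^2 + g^2)/2, and the
  unit marginals turn this into half the sum of the squared norms of \<open>f\<close> and
  \<open>g\<close>.\<close>

lemma kernel_op_contraction:
  assumes nonneg: "AE (x, y) in M \<Otimes>\<^sub>M N. 0 \<le> k x y"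
    and row: "AE y in N. (\<integral>x. k x y \<partial>M) = 1" and col: "AE x in M. (\<integral>y. k x y \<partial>N) = 1"
    and f: "f \<in> l2_space M"
  shows "l2_inner N (kernel_op M k f) (kernel_op M k f) \<le> l2_inner M f f"
proof -
  interpret Q: l2_kernel N M "\<lambda>y x. k x y" by (rule l2_kernel_swap)
  define g where "g = kernel_op M k f"
  have g: "g \<in> l2_space N" unfolding g_def using f by (rule kernel_op_l2)
  have nn1: "AE x in M. AE y in N. 0 \<le> k x y"
    using AE_pair[OF nonneg] by simp
  have "(AE x in M. AE y in N. 0 \<le> k x y) \<longleftrightarrow> (AE y in N. AE x in M. 0 \<le> k x y)"
    by (rule AE_commute) measurable
  with nn1 have nn2: "AE y in N. AE x in M. 0 \<le> k x y" by simp
  note F = integral_kernel_square[OF nn1 col f]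
  have G: "integrable (M \<Otimes>\<^sub>M N) (\<lambda>(x, y). k x y * (g y)\<^sup>2)"
    using Q.integrable_product_swap[OF Q.integral_kernel_square(1)[OF nn2 row g]] by simp
  have G': "(\<integral>(x, y). k x y * (g y)\<^sup>2 \<partial>(M \<Otimes>\<^sub>M N)) = l2_inner N g g"
    using Q.integral_kernel_square(2)[OF nn2 row g]
      Q.integral_product_swap[OF borel_measurable_integrable[OF Q.integral_kernel_square(1)[OF nn2 row g]]]
    by simp
  have "l2_inner N g g = (\<integral>(x, y). k x y * (f x * g y) \<partial>(M \<Otimes>\<^sub>M N))"
    using integral_snd[OF integrable_kernel_mult[OF f g]] by (simp add: inner_kernel_op g_def)
  also have "\<dots> \<le> (\<integral>z. ((case z of (x, y) \<Rightarrow> k x y * (f x)\<^sup>2) + (case z of (x, y) \<Rightarrow> k x y * (g y)\<^sup>2)) / 2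
      \<partial>(M \<Otimes>\<^sub>M N))"
  proof (rule integral_mono_AE)
    show "integrable (M \<Otimes>\<^sub>M N) (\<lambda>(x, y). k x y * (f x * g y))"
      by (rule integrable_kernel_mult[OF f g])
    show "integrable (M \<Otimes>\<^sub>M N) (\<lambda>z. ((case z of (x, y) \<Rightarrow> k x y * (f x)\<^sup>2)
        + (case z of (x, y) \<Rightarrow> k x y * (g y)\<^sup>2)) / 2)"
      by (intro integrable_divide Bochner_Integration.integrable_add[OF F(1) G])
    show "AE z in M \<Otimes>\<^sub>M N. (case z of (x, y) \<Rightarrow> k x y * (f x * g y))
        \<le> ((case z of (x, y) \<Rightarrow> k x y * (f x)\<^sup>2) + (case z of (x, y) \<Rightarrow> k x y * (g y)\<^sup>2)) / 2"
      using nonneg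
    proof eventually_elim
      case (elim z)
      obtain x y where z: "z = (x, y)" by (cases z)
      have "f x * g y \<le> ((f x)\<^sup>2 + (g y)\<^sup>2) / 2"
        using abs_mult_le_mean_squares order_trans abs_ge_self by metis
      then have "k x y * (f x * g y) \<le> k x y * (((f x)\<^sup>2 + (g y)\<^sup>2) / 2)"
        by (rule mult_left_mono) (use elim z in simp)
      then show ?case by (simp add: z distrib_left)
    qed
  qed
  also have "\<dots> = (l2_inner M f f + l2_inner N g g) / 2"
    using F G by (simp add: G')
  finally show ?thesis by (simp add: g_def)
qed

end

text \<open>Power iteration from \<open>f\<close> gives an eigenfunction orthogonal to
  \<open>u\<close> whose eigenvalue \<open>r\<close> is at least the Rayleigh quotient of
  \<open>f\<close>. By \<open>top\<close>, \<open>r \<le> s\<close>, so the smaller of the two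
  eigenvalues is \<open>r\<close> and lies below \<open>lam 2\<close>.\<close>

lemma (in l2_kernel_adjoint) second_eigenvalue_bound:
  assumes lam: "is_eigenvalue_seq M A lam"
    and u: "u \<in> l2_eigenspace M A s" "l2_inner M u u \<noteq> 0" "0 < s"
    and top: "\<And>f. f \<in> l2_space M \<Longrightarrow>
      l2_inner N (kernel_op M k f) (kernel_op M k f) \<le> s * l2_inner M f f"
    and f: "f \<in> l2_space M" and orth: "l2_inner M f u = 0"
  shows "l2_inner N (kernel_op M k f) (kernel_op M k f) \<le> lam 2 * l2_inner M f f"
proof (cases "l2_inner N (kernel_op M k f) (kernel_op M k f) = 0")
  case True
  then show ?thesis using lam by (simp add: is_eigenvalue_seq_def)
next
  case False
  then have "0 < l2_inner N (kernel_op M k f) (kernel_op M k f)"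
    using l2_inner_self_nonneg[of N "kernel_op M k f"] by linarith
  then obtain r g where r: "0 < r"
      "l2_inner N (kernel_op M k f) (kernel_op M k f) \<le> r * l2_inner M f f"
    and g: "g \<in> l2_eigenspace M A r" "l2_inner M g g \<noteq> 0"
    and perp: "\<And>t h. h \<in> l2_eigenspace M A t \<Longrightarrow> l2_inner M f h = 0 \<Longrightarrow> l2_inner M g h = 0"
    using top_of_cyclic_spectrum_is_eigenvalue[OF f] by metis
  have "r * l2_inner M g g \<le> s * l2_inner M g g"
    using eigenspace_norm_kernel_op[OF g(1)] top[of g] g(1) by (simp add: l2_eigenspace_def)
  then have "r \<le> s" using g(2) l2_inner_self_nonneg[of M g] by (simp add: mult_le_cancel_right)
  moreover have "l2_inner M u g = 0" using perp[OF u(1) orth] by (simp add: l2_inner_commute)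
  ultimately have "r \<le> lam 2" using second_eigenvalue_ge[OF lam u g r(1)] by simp
  then have "r * l2_inner M f f \<le> lam 2 * l2_inner M f f" by (rule mult_right_mono) simp
  then show ?thesis using r(2) by linarith
qed

theorem theorem2:
  fixes M :: "'a measure" and N :: "'b measure"
    and k :: "'a \<Rightarrow> 'b \<Rightarrow> real"
    and L :: "('a \<Rightarrow> real) \<Rightarrow> ('b \<Rightarrow> real)"
    and X1 X2 :: "'a set" and Y1 Y2 :: "'b set"
  assumes "prob_space M" and "prob_space N"
    and k_l2: "(\<lambda>(x, y). k x y) \<in> l2_space (M \<Otimes>\<^sub>M N)"
    and k_nonneg: "AE (x, y) in M \<Otimes>\<^sub>M N. 0 \<le> k x y"
    and L_kernel: "L = kernel_op M k"
    and L_one: "AE y in N. L (\<lambda>_. 1) y = 1"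
    and L_adj_one: "AE x in M. l2_adjoint M N L (\<lambda>_. 1) x = 1"
    and simple: "simple_singular_value M N L 1"
    and "measurable_bipartition M X1 X2" and "measurable_bipartition N Y1 Y2"
    and "measure M X1 = measure N Y1" and "measure M X2 = measure N Y2"
    and "measure M X1 > 0" and "measure M X2 > 0"
  shows "l2_inner N (L (indicator X1)) (indicator Y1) / measure M X1
       + l2_inner N (L (indicator X2)) (indicator Y2) / measure M X2
       \<le> 1 + singular_value M N L 2"
proof -

  \<comment> \<open>Constants as eigenfunctions and the bound on their orthogonal complement\<close>
  interpret P: prob_space M by fact
  interpret Q: prob_space N by fact
  interpret pair_sigma_finite M N ..
  interpret K: l2_kernel M N k by standard (rule k_l2)
  define T where "T = l2_adjoint M N L"
  have "\<exists>S. is_l2_adjoint M N (kernel_op M k) S" using K.is_l2_adjoint_swap by blast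
  then have adj: "is_l2_adjoint M N (kernel_op M k) T"
    unfolding T_def l2_adjoint_def L_kernel by (rule someI_ex)
  interpret K: l2_kernel_adjoint M N k T by standard (rule adj)
  define lam where "lam = eigenvalue_seq M (T \<circ> L)"
  have lam: "is_eigenvalue_seq M (T \<circ> kernel_op M k) lam"
    unfolding lam_def eigenvalue_seq_def L_kernel by (rule someI_ex[OF K.eigenvalue_seq_exists])
  have \<sigma>: "singular_value M N L 2 = sqrt (lam 2)" by (simp add: singular_value_def lam_def T_def)
  have one: "(\<lambda>_. 1) \<in> l2_space M" "(\<lambda>_. 1) \<in> l2_space N"
    by (rule l2_const, unfold_locales)+
  have T: "T g \<in> l2_space M" if "g \<in> l2_space N" for g
    using adj that by (simp add: is_l2_adjoint_def)
  have L_T: "l2_inner N (L f) g = l2_inner M f (T g)" if "f \<in> l2_space M" "g \<in> l2_space N" for f g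
    using adj that by (simp add: is_l2_adjoint_def L_kernel)
  have L_l2: "L f \<in> l2_space N" if "f \<in> l2_space M" for f
    using K.kernel_op_l2[OF that] by (simp add: L_kernel)
  have L1: "l2_inner N (L (\<lambda>_. 1)) g = l2_inner N (\<lambda>_. 1) g" if "g \<in> l2_space N" for g
    by (rule l2_inner_cong_AE[OF L_one]) (use one L_l2 that in \<open>auto dest: l2_spaceD\<close>)
  have T1: "l2_inner N (L f) (\<lambda>_. 1) = l2_inner M f (\<lambda>_. 1)" if f: "f \<in> l2_space M" for f
  proof -
    have "l2_inner M (T (\<lambda>_. 1)) f = l2_inner M (\<lambda>_. 1) f"
      by (rule l2_inner_cong_AE) (use L_adj_one one T f in \<open>auto dest: l2_spaceD simp: T_def\<close>)
    then show ?thesis using L_T[OF f one(2)] by (simp add: l2_inner_commute)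
  qed
  have row: "AE y in N. (\<integral>x. k x y \<partial>M) = 1"
    using L_one by (simp add: L_kernel kernel_op_def)
  \<comment> \<open>Condition (3) concerns the selected adjoint. Any two adjoints agree almost
    everywhere, so it becomes a condition on the kernel.\<close>
  have "AE x in M. T (\<lambda>_. 1) x = kernel_op N (\<lambda>y x. k x y) (\<lambda>_. 1) x"
  proof (rule l2_AE_eqI)
    have S: "is_l2_adjoint M N (kernel_op M k) (kernel_op N (\<lambda>y x. k x y))"
      by (rule K.is_l2_adjoint_swap)
    show "T (\<lambda>_. 1) \<in> l2_space M" by (rule T[OF one(2)])
    show "kernel_op N (\<lambda>y x. k x y) (\<lambda>_. 1) \<in> l2_space M"
      using S one by (simp add: is_l2_adjoint_def)
    show "l2_inner M (T (\<lambda>_. 1)) h = l2_inner M (kernel_op N (\<lambda>y x. k x y) (\<lambda>_. 1)) h"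
      if "h \<in> l2_space M" for h
      using S adj one that by (simp add: is_l2_adjoint_def l2_inner_commute[of M _ h])
  qed
  then have col: "AE x in M. (\<integral>y. k x y \<partial>N) = 1"
    using L_adj_one unfolding T_def by eventually_elim (simp add: kernel_op_def)
  have one_one: "l2_inner M (\<lambda>_. 1) (\<lambda>_. 1) = 1" by (simp add: l2_inner_def P.prob_space)
  have eig: "(\<lambda>_. 1) \<in> l2_eigenspace M (T \<circ> kernel_op M k) 1"
    unfolding K.eigenspace_iff
  proof (intro conjI ballI one)
    fix h assume h: "h \<in> l2_space M"
    have "l2_inner M (\<lambda>_. 1) ((T \<circ> kernel_op M k) h) = l2_inner N (L (\<lambda>_. 1)) (L h)"
      using K.A_sym[OF one(1) h] K.A_inner[OF one(1) h] by (simp add: L_kernel)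
    also have "\<dots> = l2_inner N (L h) (\<lambda>_. 1)" using L1[OF L_l2[OF h]] by (simp add: l2_inner_commute)
    also have "\<dots> = 1 * l2_inner M (\<lambda>_. 1) h" using T1[OF h] by (simp add: l2_inner_commute)
    finally show "l2_inner M (\<lambda>_. 1) ((T \<circ> kernel_op M k) h) = 1 * l2_inner M (\<lambda>_. 1) h" .
  qed
  \<comment> \<open>Here \<open>u\<close> is the constant 1 and \<open>s = 1\<close>; the
    contraction property shows that 1 is the top of the spectrum.\<close>
  have gap: "l2_inner N (L f) (L f) \<le> lam 2 * l2_inner M f f"
    if "f \<in> l2_space M" "l2_inner M f (\<lambda>_. 1) = 0" for f
    unfolding L_kernel
    by (rule K.second_eigenvalue_bound[OF lam eig])
       (use that one_one K.kernel_op_contraction[OF k_nonneg row col] in simp_all)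

  \<comment> \<open>Centred indicators and their norms\<close>
  define p where "p = measure M X1"
  have X: "X1 \<in> sets M" "X2 \<in> sets M" "X1 \<inter> X2 = {}" "X1 \<union> X2 = space M"
    and Y: "Y1 \<in> sets N" "Y2 \<in> sets N" "Y1 \<inter> Y2 = {}" "Y1 \<union> Y2 = space N"
    using assms(9,10) by (auto simp: measurable_bipartition_def)
  have X2: "measure M X2 = 1 - p"
    using P.finite_measure_Union[OF X(1-3)] P.prob_space X(4) by (simp add: p_def)
  have p: "0 < p" "p < 1" using assms(13,14) X2 by (auto simp: p_def)
  have Y1: "measure N Y1 = p" and Y2: "measure N Y2 = 1 - p" using assms(11,12) X2 by (auto simp: p_def)
  have ind: "indicator X1 \<in> l2_space M" "indicator X2 \<in> l2_space M"
    "indicator Y1 \<in> l2_space N" "indicator Y2 \<in> l2_space N"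
    using X Y P.finite_measure_axioms Q.finite_measure_axioms by (auto intro: l2_indicator)
  \<comment> \<open>The two functions differ outside \<open>space M\<close>, so the identity is
    stated for inner products.\<close>
  have ind_X2: "l2_inner M (indicator X2) h = l2_inner M (\<lambda>x. 1 - indicator X1 x) h" for h
    unfolding l2_inner_def by (rule Bochner_Integration.integral_cong) (use X in \<open>auto simp: indicator_def\<close>)
  have ind_Y2: "l2_inner N h (indicator Y2) = l2_inner N h (\<lambda>x. 1 - indicator Y1 x)" for h
    unfolding l2_inner_def by (rule Bochner_Integration.integral_cong) (use Y in \<open>auto simp: indicator_def\<close>)
  have inner_X1: "l2_inner M (indicator X1) (\<lambda>_. 1) = p" "l2_inner M (indicator X1) (indicator X1) = p"
    using X by (auto simp: l2_inner_def p_def simp flip: indicator_inter_arith)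
  have inner_Y: "l2_inner N (\<lambda>_. 1) (indicator Y1) = p" "l2_inner N (\<lambda>_. 1) (indicator Y2) = 1 - p"
    "l2_inner N (indicator Y1) (indicator Y1) = p" "l2_inner N (\<lambda>_. 1) (\<lambda>_. 1) = 1"
    using Y Y1 Y2 by (auto simp: l2_inner_def Q.prob_space simp flip: indicator_inter_arith)
  define f where "f = (\<lambda>x. indicator X1 x - p)"
  define g where "g = (\<lambda>y. indicator Y1 y - p)"
  have const: "(\<lambda>_. c) \<in> l2_space M" "(\<lambda>_. c) \<in> l2_space N" for c :: real
    by (rule l2_const, unfold_locales)+
  have const_inner: "l2_inner M (\<lambda>_. c) h = c * l2_inner M (\<lambda>_. 1) h"
    "l2_inner N (\<lambda>_. c) h' = c * l2_inner N (\<lambda>_. 1) h'"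
    "l2_inner M h (\<lambda>_. c) = c * l2_inner M h (\<lambda>_. 1)"
    "l2_inner N h' (\<lambda>_. c) = c * l2_inner N h' (\<lambda>_. 1)" for c :: real and h h'
    using l2_inner_scale_left[of M c "\<lambda>_. 1" h] l2_inner_scale_left[of N c "\<lambda>_. 1" h']
      l2_inner_scale_right[of M h c "\<lambda>_. 1"] l2_inner_scale_right[of N h' c "\<lambda>_. 1"] by simp_all
  have f: "f \<in> l2_space M" unfolding f_def by (intro l2_diff ind const)
  have g: "g \<in> l2_space N" unfolding g_def by (intro l2_diff ind const)
  have f_one: "l2_inner M f (\<lambda>_. 1) = 0"
    unfolding f_def using one_one
    by (simp add: l2_inner_diff_left[OF ind(1) const(1) one(1)] const_inner(1)[of p] inner_X1)
  have ff: "l2_inner M f f = p * (1 - p)"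
  proof -
    have "l2_inner M f f = l2_inner M f (indicator X1) - p * l2_inner M f (\<lambda>_. 1)"
      using l2_inner_diff_right[OF ind(1) const(1)[of p] f] const_inner(3)[of f p] by (simp add: f_def)
    also have "l2_inner M f (indicator X1) = p - p * p"
      using l2_inner_diff_left[OF ind(1) const(1)[of p] ind(1)] const_inner(1)[of p "indicator X1"]
      by (simp add: f_def inner_X1 l2_inner_commute[of M "\<lambda>_. 1"])
    finally show ?thesis by (simp add: f_one algebra_simps)
  qed
  have gg: "l2_inner N g g = p * (1 - p)"
  proof -
    have "l2_inner N g g = l2_inner N g (indicator Y1) - p * l2_inner N g (\<lambda>_. 1)"
      using l2_inner_diff_right[OF ind(3) const(2)[of p] g] const_inner(4)[of g p] by (simp add: g_def)
    also have "l2_inner N g (indicator Y1) = p - p * p"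
      using l2_inner_diff_left[OF ind(3) const(2)[of p] ind(3)] const_inner(2)[of p "indicator Y1"]
      by (simp add: g_def inner_Y)
    also have "l2_inner N g (\<lambda>_. 1) = 0"
      using l2_inner_diff_left[OF ind(3) const(2)[of p] one(2)] const_inner(2)[of p "\<lambda>_. 1"]
      by (simp add: g_def inner_Y l2_inner_commute[of N "indicator Y1"])
    finally show ?thesis by (simp add: algebra_simps)
  qed

  \<comment> \<open>Reduction to one inner product and conclusion\<close>
  define a where "a = l2_inner N (L (indicator X1)) (indicator Y1)"
  have L_X1: "l2_inner N (L (indicator X1)) (\<lambda>_. 1) = p" using T1[OF ind(1)] inner_X1 by simp
  have c: "l2_inner N (L f) g = a - p * p"
  proof -
    \<comment> \<open>Passing to the adjoint reduces linearity in the argument of \<open>L\<close>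
      to linearity of the inner product.\<close>
    have "l2_inner N (L f) g = l2_inner M (indicator X1) (T g) - p * l2_inner M (\<lambda>_. 1) (T g)"
      using L_T[OF f g] l2_inner_diff_left[OF ind(1) const(1)[of p] T[OF g]] const_inner(1)[of p "T g"]
      by (simp add: f_def)
    also have "l2_inner M (indicator X1) (T g) = a - p * p"
      using L_T[OF ind(1) g] l2_inner_diff_right[OF ind(3) const(2)[of p] L_l2[OF ind(1)]]
        const_inner(4)[of "L (indicator X1)" p] L_X1
      by (simp add: g_def a_def)
    also have "l2_inner M (\<lambda>_. 1) (T g) = 0"
      using L_T[OF one(1) g] L1[OF g] l2_inner_diff_right[OF ind(3) const(2)[of p] one(2)]
        const_inner(4)[of "\<lambda>_. 1" p] by (simp add: g_def inner_Y)
    finally show ?thesis by simp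
  qed
  \<comment> \<open>Since \<open>L\<close> and its adjoint preserve constants, all four block masses
    are determined by \<open>a\<close> and \<open>p\<close>, so the second summand can be expressed
    through the first.\<close>
  have a2: "l2_inner N (L (indicator X2)) (indicator Y2) = 1 - 2 * p + a"
  proof -
    have "l2_inner N (L (indicator X2)) (indicator Y2) = l2_inner M (indicator X2) (T (indicator Y2))"
      by (rule L_T) (rule ind)+
    also have "\<dots> = l2_inner M (\<lambda>_. 1) (T (indicator Y2)) - l2_inner M (indicator X1) (T (indicator Y2))"
      unfolding ind_X2 by (rule l2_inner_diff_left[OF one(1) ind(1) T[OF ind(4)]])
    also have "l2_inner M (\<lambda>_. 1) (T (indicator Y2)) = 1 - p"
      using L_T[OF one(1) ind(4)] L1[OF ind(4)] inner_Y by simp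
    also have "l2_inner M (indicator X1) (T (indicator Y2)) = l2_inner N (L (indicator X1)) (indicator Y2)"
      using L_T[OF ind(1) ind(4)] by simp
    also have "\<dots> = p - a"
      unfolding ind_Y2 a_def using l2_inner_diff_right[OF one(2) ind(3) L_l2[OF ind(1)]] L_X1 by simp
    finally show ?thesis by simp
  qed
  have pq: "0 < p * (1 - p)" using p by simp
  have "l2_inner N (L f) g \<le> sqrt (l2_inner N (L f) (L f)) * sqrt (l2_inner N g g)"
    using l2_Cauchy_Schwarz_abs[OF L_l2[OF f] g] by linarith
  also have "\<dots> \<le> sqrt (lam 2 * (p * (1 - p))) * sqrt (p * (1 - p))"
    unfolding gg using gap[OF f f_one] pq
    by (intro mult_right_mono real_sqrt_le_mono) (simp_all add: ff)
  also have "\<dots> = sqrt (lam 2) * (p * (1 - p))"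
    using pq by (simp only: real_sqrt_mult[of "lam 2"] mult.assoc real_sqrt_mult_self abs_of_pos)
  finally have main: "a - p * p \<le> sqrt (lam 2) * (p * (1 - p))" by (simp add: c)
  have "a / p + (1 - 2 * p + a) / (1 - p) = 1 + (a - p * p) / (p * (1 - p))"
    using p by (simp add: field_simps)
  also have "(a - p * p) / (p * (1 - p)) \<le> sqrt (lam 2)"
    using main pq by (simp add: pos_divide_le_eq)
  finally show ?thesis by (simp add: a2 X2 \<sigma> flip: a_def p_def)
qed

end
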